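(* The spaces $L(\mathfrak S_n)$ and $\mathbb H_n$ are isomorphic as representations of the symmetric group $\mathfrak S_n$. In particular, $$\sum_{k\in\{0,2,3,\dots,n\}}\kappa_\lambda^k=d_\lambda\qquad\text{for every partition }\lambda\vdash n.$$
   Context: Let $n\ge 1$ and $[n]=\{1,\dots,n\}$. For a finite set $E$: $\mathcal P(E)=\{A\subset E: |A|\ge 2\}$, $\bar{\mathcal P}(E)=\mathcal P(E)\cup\{\emptyset\}$, $L(E)$ is the space of functions $E\to\mathbb R$, $\delta_x$ is the Dirac function at $x$. An injective word on $[n]$ is a finite sequence $\pi=\pi_1\cdots\pi_k$ of distinct elements of $[n]$; its content is $c(\pi)=\{\pi_1,\dots,\pi_k\}$. The empty word is $\bar 0$, with content $\emptyset$. $\Gamma(A)$ is the set of injective words with content $A$ (so $\Gamma(\emptyset)=\{\bar 0\}$), $\Gamma_n=\bigsqcup_{A\in\mathcal P([n])}\Gamma(A)$, $\bar\Gamma_n=\Gamma_n\cup\{\bar 0\}$. Each $L(\Gamma(A))$ is embedded in $L(\bar\Gamma_n)$ by extension by zero. $\pi\subset\sigma$ means that $\pi$ is a (not necessarily contiguous) subword of $\sigma$. Marginal operators: for $A\in\mathcal P([n])$, $M_AF(\pi)=\sum_{\sigma\in\Gamma_n,\,\pi\subset\sigma}F(\sigma)$ for $\pi\in\Gamma(A)$; $M_\emptyset F=\big(\sum_{\pi\in\bar\Gamma_n}F(\pi)\big)\delta_{\bar 0}$; $M_A=M_\emptyset$ if $|A|=1$. Spaces: $H_\emptyset=L(\Gamma(\emptyset))=\mathbb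 R\delta_{\bar 0}$; for $B\in\mathcal P([n])$, $H_B=\{F\in L(\Gamma(B)): M_{B'}F=0\text{ for all }B'\subsetneq B\}$; $\mathbb H_n=\bigoplus_{B\in\bar{\mathcal P}([n])}H_B$; for $k\in\{0,2,\dots,n\}$, $H^k=\bigoplus_{B\subset[n],\,|B|=k}H_B$. Action: $\sigma\in\mathfrak S_n$ acts on words by $\sigma\cdot(\pi_1\cdots\pi_k)=\sigma(\pi_1)\cdots\sigma(\pi_k)$, $\sigma\cdot\bar 0=\bar 0$, and on $L(\bar\Gamma_n)$ by the linear maps $T_\sigma\delta_\pi=\delta_{\sigma\cdot\pi}$. The spaces $H^k$ and $\mathbb H_n$ are stable under all $T_\sigma$ and thus are representations of $\mathfrak S_n$. A word $\pi\in\Gamma([n])$ is identified with the permutation mapping $\pi_i$ to $i$, so that $L(\Gamma([n]))$ is identified with $L(\mathfrak S_n)$; the action of $\tau$ becomes $\delta_\sigma\mapsto\delta_{\sigma\tau^{-1}}$ (right regular representation). $S^\lambda$, $\lambda\vdash n$, are the Specht modules (irreducible representations of $\mathfrak S_n$), $d_\lambda=\dim S^\lambda$, and $\kappa_\lambda^k$ is the multiplicity of $S^\lambda$ in $H^k$. *)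

theory Defs
  imports
    "HOL-Analysis.Analysis"
    "HOL-Library.Function_Algebras"
    "HOL-Library.Sublist"
    "HOL-Algebra.Sym_Groups"
begin

section \<open>Spaces of real functions\<close>

instantiation "fun" :: (type, real_vector) real_vector
begin

definition scaleR_fun_def: "c *\<^sub>R f = (\<lambda>x. c *\<^sub>R f x)"

instance
  by intro_classes (auto simp: fun_eq_iff scaleR_fun_def scaleR_add_left scaleR_add_right)

end

lemma scaleR_fun_apply [simp]: "(c *\<^sub>R f) x = c *\<^sub>R f x"
  by (simp add: scaleR_fun_def)

lemma sum_fun_apply: "(\<Sum>i\<in>I. f i) x = (\<Sum>i\<in>I. f i x)"
  by (induction I rule: infinite_finite_induct) auto

text \<open>
  Functions on a set \<open>E\<close> are functions on the whole type that vanish outside \<open>E\<close>; so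
  \<open>L_space A \<subseteq> L_space E\<close> for \<open>A \<subseteq> E\<close> is the embedding by extension by zero.
\<close>

definition L_space :: "'a set \<Rightarrow> ('a \<Rightarrow> real) set"
  where "L_space E = {F. \<forall>x. x \<notin> E \<longrightarrow> F x = 0}"

definition dirac :: "'a \<Rightarrow> 'a \<Rightarrow> real"
  where "dirac x = indicator {x}"

lemma subspace_L_space: "subspace (L_space E)"
  by (auto simp: subspace_def L_space_def)

section \<open>Sums of subspaces\<close>

definition subspace_sum :: "'i set \<Rightarrow> ('i \<Rightarrow> 'v::real_vector set) \<Rightarrow> 'v set"
  where "subspace_sum I V = {\<Sum>i\<in>I. f i | f. \<forall>i\<in>I. f i \<in> V i}"

definition independent_family :: "'i set \<Rightarrow> ('i \<Rightarrow> 'v::real_vector set) \<Rightarrow> bool"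
  where "independent_family I V \<longleftrightarrow>
    (\<forall>f. (\<forall>i\<in>I. f i \<in> V i) \<and> (\<Sum>i\<in>I. f i) = 0 \<longrightarrow> (\<forall>i\<in>I. f i = 0))"

section \<open>Real representations of a group\<close>

text \<open>
  A representation is a subspace \<open>V\<close> of an ambient real vector space together with operators
  \<open>T g\<close>, defined on the ambient space, that preserve \<open>V\<close> and satisfy the group laws on \<open>V\<close>.
\<close>

definition representation ::
    "('g, 'm) monoid_scheme \<Rightarrow> 'v::real_vector set \<Rightarrow> ('g \<Rightarrow> 'v \<Rightarrow> 'v) \<Rightarrow> bool"
  where "representation G V T \<longleftrightarrow>
    group G \<and> subspace V \<and>
    (\<forall>g\<in>carrier G. linear (T g) \<and> T g ` V \<subseteq> V) \<and>
    (\<forall>v\<in>V. T \<one>\<^bsub>G\<^esub> v = v) \<and>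
    (\<forall>g\<in>carrier G. \<forall>h\<in>carrier G. \<forall>v\<in>V. T (g \<otimes>\<^bsub>G\<^esub> h) v = T g (T h v))"

text \<open>
  Every linear map defined on a subspace extends to the ambient space, so it is no restriction that
  the isomorphism \<open>\<phi>\<close> below is the restriction to \<open>V\<close> of a linear map on the ambient space.
\<close>

definition rep_isomorphic ::
    "('g, 'm) monoid_scheme \<Rightarrow> 'v::real_vector set \<Rightarrow> ('g \<Rightarrow> 'v \<Rightarrow> 'v) \<Rightarrow>
      'w::real_vector set \<Rightarrow> ('g \<Rightarrow> 'w \<Rightarrow> 'w) \<Rightarrow> bool"
  where "rep_isomorphic G V T W U \<longleftrightarrow>
    representation G V T \<and> representation G W U \<and>
    (\<exists>\<phi>. linear \<phi> \<and> bij_betw \<phi> V W \<and> (\<forall>g\<in>carrier G. \<forall>v\<in>V. \<phi> (T g v) = U g (\<phi> v)))"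

definition irreducible_rep ::
    "('g, 'm) monoid_scheme \<Rightarrow> 'v::real_vector set \<Rightarrow> ('g \<Rightarrow> 'v \<Rightarrow> 'v) \<Rightarrow> bool"
  where "irreducible_rep G V T \<longleftrightarrow>
    representation G V T \<and> V \<noteq> {0} \<and>
    (\<forall>W. W \<subseteq> V \<and> representation G W T \<longrightarrow> W = {0} \<or> W = V)"

text \<open>
  The multiplicity of the irreducible representation \<open>(S, U)\<close> in \<open>(V, T)\<close> is the number of summands
  isomorphic to it in a decomposition of \<open>V\<close> as an internal direct sum of irreducible
  subrepresentations (such summands are nonzero and independent, hence distinct, so that a set of
  subspaces loses no information).
\<close>

definition multiplicity_rep ::
    "('g, 'm) monoid_scheme \<Rightarrow> 's::real_vector set \<Rightarrow> ('g \<Rightarrow> 's \<Rightarrow> 's) \<Rightarrow>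
      'v::real_vector set \<Rightarrow> ('g \<Rightarrow> 'v \<Rightarrow> 'v) \<Rightarrow> nat"
  where "multiplicity_rep G S U V T =
    (THE m. \<exists>\<W>. finite \<W> \<and> (\<forall>W\<in>\<W>. irreducible_rep G W T) \<and>
       independent_family \<W> (\<lambda>W. W) \<and> subspace_sum \<W> (\<lambda>W. W) = V \<and>
       card {W \<in> \<W>. rep_isomorphic G S U W T} = m)"

section \<open>Injective words, marginals and the spaces of the decomposition\<close>

definition \<P> :: "'a set \<Rightarrow> 'a set set"
  where "\<P> E = {A. A \<subseteq> E \<and> card A \<ge> 2}"

definition \<P>bar :: "'a set \<Rightarrow> 'a set set"
  where "\<P>bar E = \<P> E \<union> {{}}"

definition \<Gamma> :: "nat set \<Rightarrow> nat list set"
  where "\<Gamma> A = {\<pi>. distinct \<pi> \<and> set \<pi> = A}"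

definition \<Gamma>\<^sub>n :: "nat \<Rightarrow> nat list set"
  where "\<Gamma>\<^sub>n n = (\<Union>A\<in>\<P> {1..n}. \<Gamma> A)"

definition \<Gamma>bar :: "nat \<Rightarrow> nat list set"
  where "\<Gamma>bar n = \<Gamma>\<^sub>n n \<union> {[]}"

text \<open>Only finite sets \<open>A\<close> with \<open>A \<subseteq> {1..n}\<close> are relevant, so \<open>card A \<le> 1\<close> means empty or singleton.\<close>

definition marginal :: "nat \<Rightarrow> nat set \<Rightarrow> (nat list \<Rightarrow> real) \<Rightarrow> nat list \<Rightarrow> real"
  where "marginal n A F =
    (if card A \<le> 1 then (\<Sum>\<pi>\<in>\<Gamma>bar n. F \<pi>) *\<^sub>R dirac []
     else (\<lambda>\<pi>. if \<pi> \<in> \<Gamma> A then \<Sum>\<sigma> | \<sigma> \<in> \<Gamma>\<^sub>n n \<and> subseq \<pi> \<sigma>. F \<sigma> else 0))"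

definition H_space :: "nat \<Rightarrow> nat set \<Rightarrow> (nat list \<Rightarrow> real) set"
  where "H_space n B =
    (if B = {} then L_space (\<Gamma> {})
     else {F \<in> L_space (\<Gamma> B). \<forall>B'. B' \<subset> B \<longrightarrow> marginal n B' F = 0})"

definition H_total :: "nat \<Rightarrow> (nat list \<Rightarrow> real) set"
  where "H_total n = subspace_sum (\<P>bar {1..n}) (H_space n)"

definition H_level :: "nat \<Rightarrow> nat \<Rightarrow> (nat list \<Rightarrow> real) set"
  where "H_level n k = subspace_sum {B. B \<subseteq> {1..n} \<and> card B = k} (H_space n)"

text \<open>The linear extension of \<open>dirac \<pi> \<mapsto> dirac (\<sigma> \<cdot> \<pi>)\<close>; see \<open>word_action_dirac\<close> below.\<close>

definition word_action :: "(nat \<Rightarrow> nat) \<Rightarrow> (nat list \<Rightarrow> real) \<Rightarrow> nat list \<Rightarrow> real"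
  where "word_action \<sigma> F = (\<lambda>\<pi>. F (map (inv' \<sigma>) \<pi>))"

section \<open>The right regular representation\<close>

definition L_sym :: "nat \<Rightarrow> ((nat \<Rightarrow> nat) \<Rightarrow> real) set"
  where "L_sym n = L_space (carrier (sym_group n))"

text \<open>The linear extension of \<open>dirac \<sigma> \<mapsto> dirac (\<sigma> \<circ> \<tau>\<inverse>)\<close>; see \<open>regular_action_dirac\<close> below.\<close>

definition regular_action :: "(nat \<Rightarrow> nat) \<Rightarrow> ((nat \<Rightarrow> nat) \<Rightarrow> real) \<Rightarrow> (nat \<Rightarrow> nat) \<Rightarrow> real"
  where "regular_action \<tau> F = (\<lambda>\<sigma>. F (\<sigma> \<circ> \<tau>))"

section \<open>Specht modules\<close>

definition integer_partition :: "nat \<Rightarrow> nat list \<Rightarrow> bool"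
  where "integer_partition n \<mu> \<longleftrightarrow>
    sorted_wrt (\<ge>) \<mu> \<and> (\<forall>p\<in>set \<mu>. p > 0) \<and> sum_list \<mu> = n"

definition young_diagram :: "nat list \<Rightarrow> (nat \<times> nat) set"
  where "young_diagram \<mu> = {(i, j). i < length \<mu> \<and> j < \<mu> ! i}"

definition tableau :: "nat \<Rightarrow> nat list \<Rightarrow> (nat \<times> nat \<Rightarrow> nat) \<Rightarrow> bool"
  where "tableau n \<mu> t \<longleftrightarrow> bij_betw t (young_diagram \<mu>) {1..n}"

text \<open>
  The tabloid of \<open>t\<close>, i.e. its class modulo permutations of the entries within the rows, is encoded
  as the list of the sets of entries of its rows.
\<close>

definition tabloid :: "nat list \<Rightarrow> (nat \<times> nat \<Rightarrow> nat) \<Rightarrow> nat set list"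
  where "tabloid \<mu> t = map (\<lambda>i. {t (i, j) | j. j < \<mu> ! i}) [0..<length \<mu>]"

definition column_stabilizer :: "nat \<Rightarrow> nat list \<Rightarrow> (nat \<times> nat \<Rightarrow> nat) \<Rightarrow> (nat \<Rightarrow> nat) set"
  where "column_stabilizer n \<mu> t =
    {\<sigma>. \<sigma> permutes {1..n} \<and>
        (\<forall>i j. (i, j) \<in> young_diagram \<mu> \<longrightarrow>
           (\<exists>i'. (i', j) \<in> young_diagram \<mu> \<and> \<sigma> (t (i, j)) = t (i', j)))}"

definition polytabloid :: "nat \<Rightarrow> nat list \<Rightarrow> (nat \<times> nat \<Rightarrow> nat) \<Rightarrow> nat set list \<Rightarrow> real"
  where "polytabloid n \<mu> t =
    (\<Sum>\<sigma>\<in>column_stabilizer n \<mu> t. of_int (sign \<sigma>) *\<^sub>R dirac (tabloid \<mu> (\<sigma> \<circ> t)))"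

definition specht :: "nat \<Rightarrow> nat list \<Rightarrow> (nat set list \<Rightarrow> real) set"
  where "specht n \<mu> = span {polytabloid n \<mu> t | t. tableau n \<mu> t}"

text \<open>The linear extension of \<open>dirac {t} \<mapsto> dirac {\<sigma> \<circ> t}\<close>; see \<open>tabloid_action_dirac\<close> below.\<close>

definition tabloid_action :: "(nat \<Rightarrow> nat) \<Rightarrow> (nat set list \<Rightarrow> real) \<Rightarrow> nat set list \<Rightarrow> real"
  where "tabloid_action \<sigma> F = (\<lambda>R. F (map (image (inv' \<sigma>)) R))"

definition \<kappa> :: "nat \<Rightarrow> nat list \<Rightarrow> nat \<Rightarrow> nat"
  where "\<kappa> n \<mu> k =
    multiplicity_rep (sym_group n) (specht n \<mu>) tabloid_action (H_level n k) word_action"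

section \<open>Consistency of the encodings\<close>

lemma word_action_dirac:
  assumes "\<sigma> permutes {1..n}"
  shows "word_action \<sigma> (dirac \<pi>) = dirac (map \<sigma> \<pi>)"
proof -
  have "map (inv' \<sigma>) x = \<pi> \<longleftrightarrow> x = map \<sigma> \<pi>" for x
    using permutes_inv_o[OF assms] by (metis list.map_comp list.map_id)
  then show ?thesis
    by (auto simp: word_action_def dirac_def fun_eq_iff indicator_def)
qed

lemma regular_action_dirac:
  assumes "\<tau> permutes {1..n}"
  shows "regular_action \<tau> (dirac \<sigma>) = dirac (\<sigma> \<circ> inv' \<tau>)"
proof -
  have "x \<circ> \<tau> = \<sigma> \<longleftrightarrow> x = \<sigma> \<circ> inv' \<tau>" for x
    using permutes_inv_o[OF assms] by (metis comp_assoc comp_id)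
  then show ?thesis
    by (auto simp: regular_action_def dirac_def fun_eq_iff indicator_def)
qed

lemma tabloid_action_dirac:
  assumes "\<sigma> permutes {1..n}"
  shows "tabloid_action \<sigma> (dirac (tabloid \<mu> t)) = dirac (tabloid \<mu> (\<sigma> \<circ> t))"
proof -
  have id: "image (inv' \<sigma>) \<circ> image \<sigma> = id" "image \<sigma> \<circ> image (inv' \<sigma>) = id"
    using permutes_inv_o[OF assms] by (metis image_comp comp_apply id_apply image_id ext)+
  have "map (image (inv' \<sigma>)) x = y \<longleftrightarrow> x = map (image \<sigma>) y" for x y
    using id by (metis list.map_comp list.map_id)
  moreover have "map (image \<sigma>) (tabloid \<mu> t) = tabloid \<mu> (\<sigma> \<circ> t)"
    by (auto simp: tabloid_def)
  ultimately show ?thesis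
    by (auto simp: tabloid_action_def dirac_def fun_eq_iff indicator_def)
qed

lemma finite_\<P>bar: "finite E \<Longrightarrow> finite (\<P>bar E)"
  by (rule finite_subset[of _ "Pow E"]) (auto simp: \<P>bar_def \<P>_def)

text \<open>The sums defining \<open>H_total\<close> and \<open>H_level\<close> are direct.\<close>

lemma independent_family_H_space:
  assumes "finite I"
  shows "independent_family I (H_space n)"
  unfolding independent_family_def
proof (intro allI impI ballI)
  fix f B assume f: "(\<forall>i\<in>I. f i \<in> H_space n i) \<and> sum f I = 0" and B: "B \<in> I"
  have out: "f A \<pi> = 0" if "A \<in> I" "\<pi> \<notin> \<Gamma> A" for A \<pi>
    using f that by (auto simp: H_space_def L_space_def split: if_splits)
  have "f B \<pi> = 0" for \<pi>
  proof (cases "\<pi> \<in> \<Gamma> B")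
    case True
    then have "(\<Sum>A\<in>I. f A \<pi>) = (\<Sum>A\<in>{B}. f A \<pi>)"
      using assms B out by (intro sum.mono_neutral_right) (auto simp: \<Gamma>_def)
    moreover have "(\<Sum>A\<in>I. f A \<pi>) = 0"
      using f sum_fun_apply[of f I \<pi>] by simp
    ultimately show ?thesis by simp
  qed (use out B in blast)
  then show "f B = 0" by (simp add: fun_eq_iff)
qed

lemma representation_L_sym: "representation (sym_group n) (L_sym n) regular_action"
proof -
  have "regular_action \<tau> F \<in> L_sym n" if "\<tau> permutes {1..n}" "F \<in> L_sym n" for \<tau> F
  proof -
    have "\<sigma> permutes {1..n}" if "(\<sigma> \<circ> \<tau>) permutes {1..n}" for \<sigma>
      using permutes_compose[OF permutes_inv[OF \<open>\<tau> permutes {1..n}\<close>] that]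
        permutes_inv_o(1)[OF \<open>\<tau> permutes {1..n}\<close>] by (simp add: comp_assoc)
    then show ?thesis
      using that by (auto simp: L_sym_def L_space_def regular_action_def sym_group_def)
  qed
  then show ?thesis
    by (auto simp: representation_def sym_group_is_group L_sym_def subspace_L_space sym_group_carrier
        sym_group_mult sym_group_one linear_iff fun_eq_iff regular_action_def comp_assoc)
qed

end

theory Submission
  imports Defs
begin

text \<open>
  The isomorphism is an explicit wavelet synthesis. For \<open>F \<in> H_space n B\<close> let \<open>synthesis F\<close> be the
  function on \<open>\<Gamma> {1..n}\<close> whose value at a word is the sum of the values of \<open>F\<close> over the contiguous
  subwords of that word. The \<open>C\<close>-marginal of \<open>synthesis F\<close> is a sum over all ways to surround a
  word with content \<open>B\<close> by the remaining letters, and each term is 0 or a value of the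
  \<open>B \<inter> C\<close>-marginal of \<open>F\<close>.
  So it vanishes unless \<open>B \<subseteq> C\<close> (\<open>word_marginal_synthesis_eq_0\<close>), and for \<open>C = B\<close> it is a nonzero
  constant multiple of \<open>F\<close> (\<open>word_marginal_synthesis_self\<close>). With respect to marginals, synthesis is
  thus triangular with invertible diagonal. Going through the sets \<open>B\<close> by increasing size, one reads
  off the summands of an element of \<open>H_total n\<close> from its synthesis, and conversely removes the
  marginals of an arbitrary function on \<open>\<Gamma> {1..n}\<close> until nothing is left. Synthesis commutes with
  renaming the letters, so it is an isomorphism of representations.

  For the multiplicities, let \<open>S\<close> be a Specht module. The summands isomorphic to \<open>S\<close> in a decomposition
  of \<open>V\<close> into irreducibles are counted by the dimension of the space of equivariant maps from \<open>S\<close> to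
  \<open>V\<close>, provided that the only endomorphisms of \<open>S\<close> are the real scalars
  (\<open>card_isomorphic_summands\<close>). That \<open>S\<close> is irreducible with this property is James's submodule
  argument: the column antisymmetrizer of a tableau maps every function on tabloids to a multiple of
  its polytabloid (\<open>column_antisymmetrizer_in_span\<close>). Decompositions of the levels \<open>H_level n k\<close>
  combine into one of \<open>H_total n\<close>, which is isomorphic to the regular representation; and the
  equivariant maps from \<open>S\<close> to the latter correspond to the linear forms on \<open>S\<close>
  (\<open>dim_hom_values_regular\<close>), a space of dimension \<open>dim S\<close>.
\<close>

section \<open>Sums of subspaces\<close>

lemma subspace_sumI: "(\<And>i. i \<in> I \<Longrightarrow> f i \<in> V i) \<Longrightarrow> (\<Sum>i\<in>I. f i) \<in> subspace_sum I V"
  by (auto simp: subspace_sum_def)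

lemma subspace_sumE:
  assumes "x \<in> subspace_sum I V"
  obtains f where "\<And>i. i \<in> I \<Longrightarrow> f i \<in> V i" "x = (\<Sum>i\<in>I. f i)"
  using assms by (auto simp: subspace_sum_def)

lemma subspace_subspace_sum:
  assumes "\<And>i. i \<in> I \<Longrightarrow> subspace (V i)"
  shows "subspace (subspace_sum I V)"
proof (rule subspaceI)
  show "0 \<in> subspace_sum I V"
    using subspace_sumI[of I "\<lambda>_. 0" V] assms by (simp add: subspace_0)
next
  fix x y assume "x \<in> subspace_sum I V" "y \<in> subspace_sum I V"
  then show "x + y \<in> subspace_sum I V"
    using assms by (elim subspace_sumE)
      (auto simp flip: sum.distrib intro!: subspace_sumI subspace_add)
next
  fix c x assume "x \<in> subspace_sum I V"
  then show "c *\<^sub>R x \<in> subspace_sum I V"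
    using assms by (elim subspace_sumE)
      (auto simp: scaleR_sum_right intro!: subspace_sumI subspace_scale)
qed

lemma summand_subset_subspace_sum:
  assumes "finite I" "\<And>i. i \<in> I \<Longrightarrow> subspace (V i)" "i \<in> I"
  shows "V i \<subseteq> subspace_sum I V"
proof
  fix x assume "x \<in> V i"
  then have "(\<Sum>j\<in>I. if j = i then x else 0) \<in> subspace_sum I V"
    using assms by (intro subspace_sumI) (auto simp: subspace_0)
  then show "x \<in> subspace_sum I V"
    using assms by simp
qed

lemma subspace_sum_subset:
  assumes "subspace U" "\<And>i. i \<in> I \<Longrightarrow> V i \<subseteq> U"
  shows "subspace_sum I V \<subseteq> U"
proof
  fix x assume "x \<in> subspace_sum I V"
  then obtain f where "\<And>i. i \<in> I \<Longrightarrow> f i \<in> V i" "x = sum f I"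
    by (rule subspace_sumE) blast
  then show "x \<in> U"
    using assms by (auto intro!: subspace_sum)
qed

lemma subspace_sum_UN:
  assumes "finite K" "\<And>k. k \<in> K \<Longrightarrow> finite (I k)"
    and "\<And>j k. j \<in> K \<Longrightarrow> k \<in> K \<Longrightarrow> j \<noteq> k \<Longrightarrow> I j \<inter> I k = {}"
  shows "subspace_sum (\<Union>k\<in>K. I k) V = subspace_sum K (\<lambda>k. subspace_sum (I k) V)"
proof (intro equalityI subsetI)
  fix x assume "x \<in> subspace_sum (\<Union>k\<in>K. I k) V"
  then obtain f where "\<And>i. i \<in> (\<Union>k\<in>K. I k) \<Longrightarrow> f i \<in> V i" "x = sum f (\<Union>k\<in>K. I k)"
    by (rule subspace_sumE) blast
  moreover have "sum f (\<Union>k\<in>K. I k) = (\<Sum>k\<in>K. sum f (I k))"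
    using assms by (intro sum.UNION_disjoint) auto
  ultimately show "x \<in> subspace_sum K (\<lambda>k. subspace_sum (I k) V)"
    by (auto intro!: subspace_sumI)
next
  fix x assume "x \<in> subspace_sum K (\<lambda>k. subspace_sum (I k) V)"
  then obtain f where f: "\<And>k. k \<in> K \<Longrightarrow> f k \<in> subspace_sum (I k) V" "x = sum f K"
    by (rule subspace_sumE) blast
  have "\<forall>k\<in>K. \<exists>g. (\<forall>i\<in>I k. g i \<in> V i) \<and> f k = sum g (I k)"
    using f(1) by (fastforce elim: subspace_sumE)
  then obtain g where g: "\<And>k i. k \<in> K \<Longrightarrow> i \<in> I k \<Longrightarrow> g k i \<in> V i"
      "\<And>k. k \<in> K \<Longrightarrow> f k = sum (g k) (I k)"
    by metis
  define h where "h i = g (THE k. k \<in> K \<and> i \<in> I k) i" for i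
  have h: "h i = g k i" if "k \<in> K" "i \<in> I k" for k i
    unfolding h_def using that assms(3) by (intro arg_cong2[of _ _ _ _ g] the_equality) blast+
  have "sum h (\<Union>k\<in>K. I k) = (\<Sum>k\<in>K. sum h (I k))"
    using assms by (intro sum.UNION_disjoint) auto
  also have "\<dots> = x"
    using f(2) g(2) h by simp
  finally show "x \<in> subspace_sum (\<Union>k\<in>K. I k) V"
    using subspace_sumI[of "\<Union>k\<in>K. I k" h V] h g(1) by (metis UN_E)
qed

lemma independent_familyD:
  assumes "independent_family I V" "\<And>i. i \<in> I \<Longrightarrow> f i \<in> V i" "(\<Sum>i\<in>I. f i) = 0" "i \<in> I"
  shows "f i = 0"
  using assms unfolding independent_family_def by blast

lemma independent_family_UN:
  assumes "finite K" "\<And>k. k \<in> K \<Longrightarrow> finite (I k)"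
    and "\<And>j k. j \<in> K \<Longrightarrow> k \<in> K \<Longrightarrow> j \<noteq> k \<Longrightarrow> I j \<inter> I k = {}"
    and "independent_family K (\<lambda>k. subspace_sum (I k) V)"
    and "\<And>k. k \<in> K \<Longrightarrow> independent_family (I k) V"
  shows "independent_family (\<Union>k\<in>K. I k) V"
  unfolding independent_family_def
proof (intro allI impI ballI)
  fix f i
  assume f: "(\<forall>i\<in>\<Union>k\<in>K. I k. f i \<in> V i) \<and> sum f (\<Union>k\<in>K. I k) = 0" and "i \<in> (\<Union>k\<in>K. I k)"
  then obtain k where k: "k \<in> K" "i \<in> I k"
    by blast
  have "sum f (\<Union>k\<in>K. I k) = (\<Sum>k\<in>K. sum f (I k))"
    using assms by (intro sum.UNION_disjoint) auto
  then have "sum f (I k) = 0"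
    using f k by (intro independent_familyD[OF assms(4), of "\<lambda>k. sum f (I k)" k])
      (auto intro: subspace_sumI)
  then show "f i = 0"
    using f k by (intro independent_familyD[OF assms(5)[OF k(1)], of f i]) auto
qed

lemma independent_family_summands_disjoint:
  assumes "independent_family I V" "finite I" "\<And>i. i \<in> I \<Longrightarrow> subspace (V i)"
    and "i \<in> I" "j \<in> I" "i \<noteq> j" "x \<in> V i" "x \<in> V j"
  shows "x = 0"
proof -
  define f where "f k = (if k = i then x else 0) + (if k = j then - x else 0)" for k
  have "(\<Sum>k\<in>I. f k) = 0"
    using assms(2,4,5) by (simp add: f_def sum.distrib)
  moreover have "f k \<in> V k" if "k \<in> I" for k
    using assms that by (auto simp: f_def subspace_0 subspace_neg)
  ultimately have "f i = 0"
    using independent_familyD[OF assms(1)] assms(4) by blast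
  then show ?thesis
    using assms(6) by (simp add: f_def)
qed

text \<open>
  A linear projection \<open>q\<close> onto the sum of the other summands leaves the map \<open>x \<mapsto> x - q x\<close>, which
  kills these summands and, by independence, is injective on \<open>V i\<close>; undoing it there gives \<open>p i\<close>.
\<close>

lemma summand_projections_exist:
  fixes V :: "'i \<Rightarrow> 'v::real_vector set"
  assumes ind: "independent_family I V" and fin: "finite I"
    and sub: "\<And>i. i \<in> I \<Longrightarrow> subspace (V i)"
  obtains p where "\<And>i. i \<in> I \<Longrightarrow> linear (p i)"
    "\<And>i f. i \<in> I \<Longrightarrow> (\<And>j. j \<in> I \<Longrightarrow> f j \<in> V j) \<Longrightarrow> p i (\<Sum>j\<in>I. f j) = f i"
proof -
  have "\<exists>p. linear p \<and> (\<forall>v\<in>V i. p v = v) \<and> (\<forall>j\<in>I - {i}. \<forall>v\<in>V j. p v = 0)"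
    if i: "i \<in> I" for i
  proof -
    define U where "U = subspace_sum (I - {i}) V"
    have U: "subspace U"
      unfolding U_def using sub by (intro subspace_subspace_sum) auto
    obtain q where q: "range q \<subseteq> U" "linear q" "\<And>u. u \<in> U \<Longrightarrow> q u = u"
      using linear_exists_left_inverse_on[OF linear_id U] by auto
    define r where "r v = v - q v" for v
    have r: "linear r"
      unfolding r_def by (intro linear_compose_sub linear_ident q(2))
    have ker: "v = 0" if v: "v \<in> V i" "r v = 0" for v
    proof -
      have "v \<in> U"
        using v(2) q(1) by (auto simp: r_def)
      then obtain f where f: "\<And>j. j \<in> I - {i} \<Longrightarrow> f j \<in> V j" "v = sum f (I - {i})"
        unfolding U_def by (rule subspace_sumE) blast
      have "(\<Sum>j\<in>I. if j = i then - v else f j) = 0"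
        using f(2) fin i by (subst sum.remove[of I i]) auto
      then have "- v = 0"
        using independent_familyD[OF ind, of "\<lambda>j. if j = i then - v else f j" i] i f(1) v(1) sub
        by (auto simp: subspace_neg split: if_splits)
      then show ?thesis by simp
    qed
    have "inj_on r (V i)"
    proof (rule inj_onI)
      fix x y assume "x \<in> V i" "y \<in> V i" "r x = r y"
      then show "x = y"
        using ker[of "x - y"] sub[OF i] linear_diff[OF r] by (simp add: subspace_diff)
    qed
    then obtain g where g: "linear g" "\<And>v. v \<in> V i \<Longrightarrow> g (r v) = v"
      using linear_exists_left_inverse_on[OF r sub[OF i]] by blast
    have "V j \<subseteq> U" if "j \<in> I - {i}" for j
      unfolding U_def using that fin sub by (intro summand_subset_subspace_sum) auto
    then have "r v = 0" if "j \<in> I - {i}" "v \<in> V j" for j v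
      using that q(3) unfolding r_def by (metis eq_iff_diff_eq_0 subsetD)
    then show ?thesis
      using g linear_compose[OF r g(1)] linear_0[OF g(1)]
      by (intro exI[of _ "g \<circ> r"]) auto
  qed
  then obtain p where p: "\<And>i. i \<in> I \<Longrightarrow> linear (p i)"
      "\<And>i v. i \<in> I \<Longrightarrow> v \<in> V i \<Longrightarrow> p i v = v"
      "\<And>i j v. i \<in> I \<Longrightarrow> j \<in> I - {i} \<Longrightarrow> v \<in> V j \<Longrightarrow> p i v = 0"
    by metis
  have "p i (\<Sum>j\<in>I. f j) = f i" if "i \<in> I" "\<And>j. j \<in> I \<Longrightarrow> f j \<in> V j" for i f
  proof -
    have "p i (\<Sum>j\<in>I. f j) = (\<Sum>j\<in>I. p i (f j))"
      using linear_sum[OF p(1)[OF that(1)]] by blast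
    also have "\<dots> = (\<Sum>j\<in>I. if j = i then f i else 0)"
      using p that by (intro sum.cong) auto
    also have "\<dots> = f i"
      using that(1) fin by simp
    finally show ?thesis .
  qed
  then show ?thesis
    using that p(1) by blast
qed

section \<open>Equivariant maps and irreducible decompositions\<close>

lemma representationD:
  assumes "representation G V T"
  shows "group G" "subspace V"
    and "\<And>g. g \<in> carrier G \<Longrightarrow> linear (T g)"
    and "\<And>g v. g \<in> carrier G \<Longrightarrow> v \<in> V \<Longrightarrow> T g v \<in> V"
    and "\<And>v. v \<in> V \<Longrightarrow> T \<one>\<^bsub>G\<^esub> v = v"
    and "\<And>g h v. g \<in> carrier G \<Longrightarrow> h \<in> carrier G \<Longrightarrow> v \<in> V \<Longrightarrow> T (g \<otimes>\<^bsub>G\<^esub> h) v = T g (T h v)"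
  using assms unfolding representation_def by blast+

lemma subrepresentation:
  assumes "representation G V T" "subspace W" "W \<subseteq> V"
    and "\<And>g w. g \<in> carrier G \<Longrightarrow> w \<in> W \<Longrightarrow> T g w \<in> W"
  shows "representation G W T"
  using assms unfolding representation_def by blast

definition equivariant ::
    "('g, 'm) monoid_scheme \<Rightarrow> 's::real_vector set \<Rightarrow> ('g \<Rightarrow> 's \<Rightarrow> 's) \<Rightarrow>
      'v::real_vector set \<Rightarrow> ('g \<Rightarrow> 'v \<Rightarrow> 'v) \<Rightarrow> ('s \<Rightarrow> 'v) \<Rightarrow> bool"
  where "equivariant G S U V T f \<longleftrightarrow>
    linear f \<and> f ` S \<subseteq> V \<and> (\<forall>g\<in>carrier G. \<forall>s\<in>S. f (U g s) = T g (f s))"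

lemma equivariantD:
  assumes "equivariant G S U V T f"
  shows "linear f" "\<And>s. s \<in> S \<Longrightarrow> f s \<in> V"
    and "\<And>g s. g \<in> carrier G \<Longrightarrow> s \<in> S \<Longrightarrow> f (U g s) = T g (f s)"
  using assms unfolding equivariant_def by blast+

lemma equivariant_compose:
  assumes "equivariant G S U V T f" "equivariant G V T W R h"
  shows "equivariant G S U W R (h \<circ> f)"
  using assms linear_compose unfolding equivariant_def by (auto simp: image_subset_iff)

lemma rep_isomorphic_iff_equivariant:
  "rep_isomorphic G V T W U \<longleftrightarrow> representation G V T \<and> representation G W U \<and>
    (\<exists>\<phi>. equivariant G V T W U \<phi> \<and> bij_betw \<phi> V W)"
  unfolding rep_isomorphic_def equivariant_def by (auto simp: bij_betw_def)

lemma equivariant_inverse: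
  assumes V: "representation G V T" and f: "equivariant G V T W R f" "bij_betw f V W"
  obtains h where "equivariant G W R V T h" "bij_betw h W V" "\<And>v. v \<in> V \<Longrightarrow> h (f v) = v"
proof -
  note V = representationD[OF V] and f1 = equivariantD[OF f(1)]
  obtain h where h: "linear h" "\<And>v. v \<in> V \<Longrightarrow> h (f v) = v"
    using linear_exists_left_inverse_on[OF f1(1) V(2)] f(2) by (auto simp: bij_betw_def)
  have W: "W = f ` V"
    using f(2) by (simp add: bij_betw_def)
  have "h ` W = V"
    using h(2) by (force simp: W)
  moreover have "inj_on h W"
    using h(2) by (auto simp: W inj_on_def)
  moreover have "h (R g w) = T g (h w)" if g: "g \<in> carrier G" "w \<in> W" for g w
  proof -
    obtain v where "v \<in> V" "w = f v"
      using g W by blast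
    then show ?thesis
      using f1(3)[OF g(1), of v] h(2) V(4)[OF g(1)] by metis
  qed
  ultimately show ?thesis
    using h by (intro that[of h]) (auto simp: equivariant_def bij_betw_def)
qed

lemma rep_isomorphic_sym:
  assumes "rep_isomorphic G V T W U"
  shows "rep_isomorphic G W U V T"
  using assms equivariant_inverse unfolding rep_isomorphic_iff_equivariant by metis

lemma representation_kernel:
  assumes V: "representation G V T" and W: "representation G W R" and f: "equivariant G V T W R f"
  shows "representation G {v \<in> V. f v = 0} T"
proof (rule subrepresentation[OF V])
  note V = representationD[OF V] and f = equivariantD[OF f]
  show "subspace {v \<in> V. f v = 0}"
    using V(2) f(1) by (auto simp: subspace_def linear_0 linear_add linear_scale)
  show "T g v \<in> {v \<in> V. f v = 0}" if "g \<in> carrier G" "v \<in> {v \<in> V. f v = 0}" for g v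
    using that V(4) f(3) linear_0[OF representationD(3)[OF W that(1)]] by auto
qed auto

lemma representation_image:
  assumes V: "representation G V T" and W: "representation G W R" and f: "equivariant G V T W R f"
  shows "representation G (f ` V) R"
proof (rule subrepresentation[OF W])
  note V = representationD[OF V] and f = equivariantD[OF f]
  show "subspace (f ` V)"
    using V(2) f(1) by (rule linear_subspace_image[rotated])
  show "R g w \<in> f ` V" if "g \<in> carrier G" "w \<in> f ` V" for g w
    using that V(4) f(3)[symmetric] by auto
  show "f ` V \<subseteq> W"
    using f(2) by blast
qed

lemma Schur:
  assumes S: "irreducible_rep G S U" and W: "irreducible_rep G W T"
    and f: "equivariant G S U W T f" and nz: "s \<in> S" "f s \<noteq> 0"
  shows "bij_betw f S W"
proof -
  have rep: "representation G S U" "representation G W T"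
    using S W by (auto simp: irreducible_rep_def)
  have "{v \<in> S. f v = 0} = {0} \<or> {v \<in> S. f v = 0} = S"
    using S representation_kernel[OF rep f] by (auto simp: irreducible_rep_def)
  then have ker: "{v \<in> S. f v = 0} = {0}"
    using nz by blast
  have "inj_on f S"
  proof (rule inj_onI)
    fix x y assume "x \<in> S" "y \<in> S" "f x = f y"
    then have "x - y \<in> {v \<in> S. f v = 0}"
      using representationD(2)[OF rep(1)] equivariantD(1)[OF f]
      by (auto simp: subspace_diff linear_diff)
    then show "x = y"
      using ker by simp
  qed
  moreover have "f ` S \<subseteq> W"
    using equivariantD(2)[OF f] by blast
  then have "f ` S = {0} \<or> f ` S = W"
    using W representation_image[OF rep f] unfolding irreducible_rep_def by blast
  ultimately show ?thesis
    using nz by (metis bij_betw_def imageI singletonD)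
qed

definition irreducible_decomposition ::
    "('g, 'm) monoid_scheme \<Rightarrow> 'v::real_vector set \<Rightarrow> ('g \<Rightarrow> 'v \<Rightarrow> 'v) \<Rightarrow> 'v set set \<Rightarrow> bool"
  where "irreducible_decomposition G V T \<W> \<longleftrightarrow>
    finite \<W> \<and> (\<forall>W\<in>\<W>. irreducible_rep G W T) \<and>
    independent_family \<W> (\<lambda>W. W) \<and> subspace_sum \<W> (\<lambda>W. W) = V"

lemma irreducible_decomposition_Union:
  assumes dec: "\<And>k. k \<in> K \<Longrightarrow> irreducible_decomposition G (V k) T (\<W> k)"
    and K: "finite K" "independent_family K V"
    and sub: "\<And>k. k \<in> K \<Longrightarrow> subspace (V k)"
  shows "irreducible_decomposition G (subspace_sum K V) T (\<Union>k\<in>K. \<W> k)"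
    and "\<And>j k. j \<in> K \<Longrightarrow> k \<in> K \<Longrightarrow> j \<noteq> k \<Longrightarrow> \<W> j \<inter> \<W> k = {}"
proof -
  have W: "finite (\<W> k)" "\<And>W. W \<in> \<W> k \<Longrightarrow> irreducible_rep G W T"
      "independent_family (\<W> k) (\<lambda>W. W)" "subspace_sum (\<W> k) (\<lambda>W. W) = V k" if "k \<in> K" for k
    using dec[OF that] by (auto simp: irreducible_decomposition_def)
  show disj: "\<W> j \<inter> \<W> k = {}" if jk: "j \<in> K" "k \<in> K" "j \<noteq> k" for j k
  proof (rule ccontr)
    assume "\<W> j \<inter> \<W> k \<noteq> {}"
    then obtain W where "W \<in> \<W> j" "W \<in> \<W> k"
      by blast
    moreover have "X \<subseteq> V l" if "X \<in> \<W> l" "l \<in> K" for X l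
      using W[OF that(2)] summand_subset_subspace_sum[of "\<W> l" "\<lambda>W. W" X] that(1)
      by (auto simp: irreducible_rep_def representation_def)
    ultimately have "W \<subseteq> {0}"
      using independent_family_summands_disjoint[OF K(2,1) sub jk] jk by blast
    moreover have "W \<noteq> {0}" "0 \<in> W"
      using W(2)[OF jk(1) \<open>W \<in> \<W> j\<close>]
      by (auto simp: irreducible_rep_def representation_def subspace_0)
    ultimately show False by blast
  qed
  have "subspace_sum K V = subspace_sum K (\<lambda>k. subspace_sum (\<W> k) (\<lambda>W. W))"
    using W(4) by (simp add: subspace_sum_def[of K])
  also have "\<dots> = subspace_sum (\<Union>k\<in>K. \<W> k) (\<lambda>W. W)"
    using K W disj by (intro subspace_sum_UN[symmetric]) auto
  finally have sum: "subspace_sum (\<Union>k\<in>K. \<W> k) (\<lambda>W. W) = subspace_sum K V" ..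
  have "independent_family K (\<lambda>k. subspace_sum (\<W> k) (\<lambda>W. W))"
    using K(2) W(4) by (simp add: independent_family_def)
  then have "independent_family (\<Union>k\<in>K. \<W> k) (\<lambda>W. W)"
    using K W disj by (intro independent_family_UN) auto
  then show "irreducible_decomposition G (subspace_sum K V) T (\<Union>k\<in>K. \<W> k)"
    using W K sum by (auto simp: irreducible_decomposition_def)
qed

text \<open>
  Averaging a linear projection onto \<open>W\<close> over the group keeps it a projection onto \<open>W\<close> and makes
  it equivariant, so that its kernel is an invariant complement.
\<close>

theorem Maschke:
  fixes G (structure)
  assumes V: "representation G V T" and W: "representation G W T" "W \<subseteq> V"
    and fin: "finite (carrier G)"
  obtains W' where "representation G W' T" "W' \<subseteq> V" "W \<inter> W' = {0}"
    "\<And>v. v \<in> V \<Longrightarrow> \<exists>w\<in>W. v - w \<in> W'"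
proof -
  note V' = representationD[OF V] and W' = representationD[OF W(1)]
  interpret group G by (rule V'(1))
  obtain q where q: "range q \<subseteq> W" "linear q" "\<And>w. w \<in> W \<Longrightarrow> q w = w"
    using linear_exists_left_inverse_on[OF linear_id W'(2)] by auto
  define c where "c = 1 / real (card (carrier G))"
  define p where "p v = c *\<^sub>R (\<Sum>g\<in>carrier G. T g (q (T (inv g) v)))" for v
  have "linear (\<lambda>v. T g (q (T (inv g) v)))" if "g \<in> carrier G" for g
    using linear_compose[OF linear_compose[OF V'(3)[of "inv g"] q(2)] V'(3)[OF that]] that
    by (simp add: o_def)
  then have lin: "linear p"
    unfolding p_def by (intro linear_compose_scale_right linear_compose_sum) blast
  have pW: "p v \<in> W" for v
    unfolding p_def using q(1) W' by (intro subspace_scale subspace_sum) auto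
  have "T g (q (T (inv g) w)) = w" if "g \<in> carrier G" "w \<in> W" for g w
  proof -
    have "T g (q (T (inv g) w)) = T g (T (inv g) w)"
      using that W'(4) q(3) by simp
    also have "\<dots> = T (g \<otimes> inv g) w"
      by (rule W'(6)[symmetric]) (use that in auto)
    finally show ?thesis
      using that W'(5) by simp
  qed
  then have pw: "p w = w" if "w \<in> W" for w
    using that fin by (simp add: p_def c_def sum_constant_scaleR card_gt_0_iff)
      (metis one_closed empty_iff)
  have eq: "p (T h v) = T h (p v)" if h: "h \<in> carrier G" and v: "v \<in> V" for h v
  proof -
    have "(\<Sum>g\<in>carrier G. T g (q (T (inv g) (T h v)))) =
        (\<Sum>g\<in>carrier G. T h (T g (q (T (inv g) v))))"
    proof (rule sum.reindex_bij_witness[of _ "\<lambda>g. h \<otimes> g" "\<lambda>g. inv h \<otimes> g"])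
      fix g assume g: "g \<in> carrier G"
      have "T h (T (inv h \<otimes> g) w) = T g w" if "w \<in> W" for w
        using W'(6)[of h "inv h \<otimes> g" w] h g that by (simp flip: m_assoc)
      moreover have "T (inv (inv h \<otimes> g)) v = T (inv g) (T h v)"
        using h g v V'(6) by (simp add: inv_mult_group)
      ultimately show "T h (T (inv h \<otimes> g) (q (T (inv (inv h \<otimes> g)) v))) = T g (q (T (inv g) (T h v)))"
        using q(1) by auto
    qed (use h in \<open>auto simp flip: m_assoc\<close>)
    then show ?thesis
      by (simp add: p_def linear_scale[OF V'(3)[OF h]] linear_sum[OF V'(3)[OF h]])
  qed
  have equi: "equivariant G V T V T p"
    using lin pW W(2) eq by (auto simp: equivariant_def)
  show ?thesis
  proof (rule that)
    show "representation G {v \<in> V. p v = 0} T"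
      by (rule representation_kernel[OF V V equi])
    show "W \<inter> {v \<in> V. p v = 0} = {0}"
      using pw W(2) subspace_0[OF W'(2)] by auto
    show "\<exists>w\<in>W. v - w \<in> {v \<in> V. p v = 0}" if "v \<in> V" for v
      using that pW[of v] pw[OF pW[of v]] W(2) V'(2) lin
      by (intro bexI[of _ "p v"]) (auto simp: linear_diff subspace_diff)
  qed auto
qed

lemma dim_less_subspace:
  fixes W V :: "'v::real_vector set"
  assumes "subspace W" "W \<subset> V" "V \<subseteq> span B" "finite B"
  shows "dim W < dim V"
proof -
  obtain C where C: "C \<subseteq> W" "independent C" "W \<subseteq> span C"
    using maximal_independent_subset by blast
  obtain D where D: "C \<subseteq> D" "D \<subseteq> V" "independent D" "V \<subseteq> span D"
    using maximal_independent_subset_extend[of C V] C assms(2) by blast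
  have "finite D"
    using independent_span_bound[OF assms(4) D(3)] D(2) assms(3) by blast
  moreover have "C \<noteq> D"
    using C(1) D(4) assms(1,2) span_minimal[of C W] by blast
  ultimately have "card C < card D"
    using D(1) psubset_card_mono by blast
  then show ?thesis
    using basis_card_eq_dim C D by metis
qed

theorem irreducible_decomposition_exists:
  assumes "representation G V T" "finite (carrier G)" "V \<subseteq> span B" "finite B"
  shows "\<exists>\<W>. irreducible_decomposition G V T \<W>"
  using assms(1,3)
proof (induction "dim V" arbitrary: V rule: less_induct)
  case less
  note rep = less.prems(1)
  have V: "subspace V"
    using rep by (rule representationD)
  consider "V = {0}" | "irreducible_rep G V T"
    | W where "representation G W T" "W \<subset> V" "W \<noteq> {0}"
    using rep by (auto simp: irreducible_rep_def)
  then show ?case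
  proof cases
    case 1
    then have "irreducible_decomposition G V T {}"
      by (auto simp: irreducible_decomposition_def independent_family_def subspace_sum_def)
    then show ?thesis ..
  next
    case 2
    then have "irreducible_decomposition G V T {V}"
      by (auto simp: irreducible_decomposition_def independent_family_def subspace_sum_def)
    then show ?thesis ..
  next
    case W: 3
    obtain W' where W': "representation G W' T" "W' \<subseteq> V" "W \<inter> W' = {0}"
        "\<And>v. v \<in> V \<Longrightarrow> \<exists>w\<in>W. v - w \<in> W'"
      using Maschke[OF rep W(1) _ assms(2)] W(2) by blast
    have "W' \<noteq> V"
      using W(2,3) W'(3) representationD(2)[OF W(1)] by (auto dest: subspace_0)
    then have "W' \<subset> V"
      using W'(2) by blast
    define X where "X b = (if b then W else W')" for b
    have X: "representation G (X b) T" "X b \<subset> V" for b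
      using W W' \<open>W' \<subset> V\<close> by (auto simp: X_def)
    have "\<exists>\<W>. irreducible_decomposition G (X b) T \<W>" for b
      using X less.prems(2) representationD(2)[OF X(1)]
      by (intro less.hyps dim_less_subspace[OF _ _ _ assms(4)]) auto
    then obtain \<W> where \<W>: "\<And>b. irreducible_decomposition G (X b) T (\<W> b)"
      by metis
    have sub: "subspace (X b)" for b
      using X(1) by (rule representationD)
    have "independent_family UNIV X"
      unfolding independent_family_def
    proof (intro allI impI ballI)
      fix f and b :: bool
      assume f: "(\<forall>b\<in>UNIV. f b \<in> X b) \<and> sum f UNIV = 0"
      then have "f True = - f False"
        by (simp add: UNIV_bool eq_neg_iff_add_eq_0 add.commute)
      moreover have "f True \<in> W" "f False \<in> W'"
        using f by (auto simp: X_def split: if_splits dest: spec)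
      ultimately have "f False = 0 \<and> f True = 0"
        using W'(3) representationD(2)[OF W'(1)] by (metis IntI neg_0_equal_iff_equal singletonD subspace_neg)
      then show "f b = 0"
        by (cases b) auto
    qed
    then have "irreducible_decomposition G (subspace_sum UNIV X) T (\<Union>b. \<W> b)"
      using \<W> sub by (intro irreducible_decomposition_Union) auto
    moreover have "subspace_sum UNIV X = V"
    proof (intro equalityI subspace_sum_subset V subsetI)
      fix v assume "v \<in> V"
      then obtain w where w: "w \<in> W" "v - w \<in> W'"
        using W'(4) by blast
      then have "(\<Sum>b\<in>UNIV. if b then w else v - w) \<in> subspace_sum UNIV X"
        by (intro subspace_sumI) (auto simp: X_def)
      then show "v \<in> subspace_sum UNIV X"
        by (simp add: UNIV_bool)
    qed (use X in auto)
    ultimately show ?thesis by auto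
  qed
qed

section \<open>Multiplicities as dimensions\<close>

text \<open>
  If the orbit of \<open>e\<close> spans \<open>S\<close>, then \<open>f \<mapsto> f e\<close> identifies the space of equivariant maps from \<open>S\<close>
  to \<open>V\<close> with the following subspace of \<open>V\<close>, whose dimension is thus that of the space of maps.
\<close>

definition hom_values ::
    "('g, 'm) monoid_scheme \<Rightarrow> 's::real_vector set \<Rightarrow> ('g \<Rightarrow> 's \<Rightarrow> 's) \<Rightarrow> 's \<Rightarrow>
      'v::real_vector set \<Rightarrow> ('g \<Rightarrow> 'v \<Rightarrow> 'v) \<Rightarrow> 'v set"
  where "hom_values G S U e V T = {f e | f. equivariant G S U V T f}"

lemma representation_span_orbit:
  assumes S: "representation G S U" and e: "e \<in> S"
  shows "representation G (span ((\<lambda>g. U g e) ` carrier G)) U"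
proof (rule subrepresentation[OF S subspace_span])
  note S' = representationD[OF S]
  interpret group G by (rule S'(1))
  let ?O = "(\<lambda>g. U g e) ` carrier G"
  show "span ?O \<subseteq> S"
    using S' e by (intro span_minimal) auto
  fix g w assume g: "g \<in> carrier G" and w: "w \<in> span ?O"
  have "U g ` ?O \<subseteq> ?O"
  proof clarify
    fix h assume h: "h \<in> carrier G"
    show "U g (U h e) \<in> ?O"
      using S'(6)[OF g h e] m_closed[OF g h] by (intro image_eqI[of _ _ "g \<otimes>\<^bsub>G\<^esub> h"]) auto
  qed
  then have "span (U g ` ?O) \<subseteq> span ?O"
    by (rule span_mono)
  then show "U g w \<in> span ?O"
    using w linear_span_image[OF S'(3)[OF g], of ?O] by blast
qed

lemma irreducible_rep_span_orbit:
  assumes S: "irreducible_rep G S U" and e: "e \<in> S" "e \<noteq> 0"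
  shows "span ((\<lambda>g. U g e) ` carrier G) = S"
proof -
  have rep: "representation G S U"
    using S by (simp add: irreducible_rep_def)
  note S' = representationD[OF rep]
  interpret group G by (rule S'(1))
  let ?O = "(\<lambda>g. U g e) ` carrier G"
  have "e \<in> ?O"
    using S'(5)[OF e(1)] by (intro image_eqI[of _ _ "\<one>\<^bsub>G\<^esub>"]) auto
  then have "span ?O \<noteq> {0}"
    using e(2) span_base[of e ?O] by blast
  moreover have "span ?O \<subseteq> S"
    using S' e by (intro span_minimal) auto
  ultimately show ?thesis
    using S representation_span_orbit[OF rep e(1)] by (auto simp: irreducible_rep_def)
qed

lemma hom_values_isomorphic:
  assumes V: "representation G V T" and \<phi>: "equivariant G V T W R \<phi>" "bij_betw \<phi> V W"
    and e: "e \<in> S"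
  shows "hom_values G S U e W R = \<phi> ` hom_values G S U e V T"
proof (intro equalityI subsetI)
  fix w assume "w \<in> hom_values G S U e W R"
  then obtain f where f: "equivariant G S U W R f" "w = f e"
    by (auto simp: hom_values_def)
  obtain h where h: "equivariant G W R V T h" "bij_betw h W V" "\<And>v. v \<in> V \<Longrightarrow> h (\<phi> v) = v"
    using equivariant_inverse[OF V \<phi>] by blast
  have "w \<in> W"
    using equivariantD(2)[OF f(1) e] f(2) by simp
  then have "w = \<phi> (h w)"
    using h(3) \<phi>(2) by (metis bij_betw_imp_surj_on imageE)
  moreover have "h w \<in> hom_values G S U e V T"
    using equivariant_compose[OF f(1) h(1)] f(2)
    by (auto simp: hom_values_def intro!: exI[of _ "h \<circ> f"])
  ultimately show "w \<in> \<phi> ` hom_values G S U e V T"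
    by blast
next
  fix w assume "w \<in> \<phi> ` hom_values G S U e V T"
  then obtain f where f: "equivariant G S U V T f" "w = (\<phi> \<circ> f) e"
    by (auto simp: hom_values_def)
  then show "w \<in> hom_values G S U e W R"
    using equivariant_compose[OF f(1) \<phi>(1)] unfolding hom_values_def by blast
qed

lemma dim_inj_image:
  fixes f :: "'v::real_vector \<Rightarrow> 'w::real_vector"
  assumes "linear f" "subspace V" "inj_on f V"
  shows "dim (f ` V) = dim V"
proof -
  obtain B where B: "B \<subseteq> V" "independent B" "V \<subseteq> span B" "card B = dim V"
    using basis_exists by blast
  have span: "span B = V"
    using B(1,3) assms(2) span_minimal by blast
  have "independent (f ` B)"
    using linear_independent_injective_image[of f B] assms B span
      linear_inj_on_span_independent_image by metis
  moreover have "f ` V \<subseteq> span (f ` B)"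
    using linear_span_image[OF assms(1), of B] span by simp
  ultimately have "card (f ` B) = dim (f ` V)"
    using B(1) by (intro basis_card_eq_dim) auto
  moreover have "card (f ` B) = card B"
    using inj_on_subset[OF assms(3) B(1)] by (rule card_image)
  ultimately show ?thesis
    using B(4) by simp
qed

lemma subspace_hom_values:
  assumes "representation G V T"
  shows "subspace (hom_values G S U e V T)"
proof (rule subspaceI)
  note V = representationD[OF assms]
  show "0 \<in> hom_values G S U e V T"
    using V(2,3) unfolding hom_values_def equivariant_def
    by (intro CollectI exI[of _ "\<lambda>_. 0"]) (auto simp: subspace_0 linear_0 linear_zero)
next
  note V = representationD[OF assms]
  fix x y assume "x \<in> hom_values G S U e V T" "y \<in> hom_values G S U e V T"
  then obtain f h where fh: "equivariant G S U V T f" "equivariant G S U V T h" "x = f e" "y = h e"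
    by (auto simp: hom_values_def)
  have "equivariant G S U V T (\<lambda>s. f s + h s)"
    using fh(1,2) V(2,3) unfolding equivariant_def
    by (auto simp: linear_compose_add linear_add image_subset_iff subspace_add)
  then show "x + y \<in> hom_values G S U e V T"
    using fh(3,4) unfolding hom_values_def by (intro CollectI exI[of _ "\<lambda>s. f s + h s"]) simp
next
  note V = representationD[OF assms]
  fix c x assume "x \<in> hom_values G S U e V T"
  then obtain f where f: "equivariant G S U V T f" "x = f e"
    by (auto simp: hom_values_def)
  have "equivariant G S U V T (\<lambda>s. c *\<^sub>R f s)"
    using f(1) V(2,3) unfolding equivariant_def
    by (auto simp: linear_compose_scale_right linear_scale image_subset_iff subspace_scale)
  then show "c *\<^sub>R x \<in> hom_values G S U e V T"
    using f(2) unfolding hom_values_def by (intro CollectI exI[of _ "\<lambda>s. c *\<^sub>R f s"]) simp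
qed

lemma dim_hom_values_isomorphic:
  assumes "rep_isomorphic G V T W R" and e: "e \<in> S"
  shows "dim (hom_values G S U e V T) = dim (hom_values G S U e W R)"
proof -
  obtain \<phi> where V: "representation G V T"
    and \<phi>: "equivariant G V T W R \<phi>" "bij_betw \<phi> V W"
    using assms(1) unfolding rep_isomorphic_iff_equivariant by blast
  have "hom_values G S U e V T \<subseteq> V"
    using equivariantD(2) e by (fastforce simp: hom_values_def)
  then have "inj_on \<phi> (hom_values G S U e V T)"
    using \<phi>(2) inj_on_subset by (auto simp: bij_betw_def)
  then show ?thesis
    unfolding hom_values_isomorphic[OF V \<phi> e]
    using dim_inj_image[OF equivariantD(1)[OF \<phi>(1)] subspace_hom_values[OF V]] by metis
qed

text \<open>
  By Schur's lemma and the assumption on endomorphisms, \<open>hom_values\<close> of an irreducible summand is a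
  line or zero, according to whether the summand is isomorphic to \<open>S\<close>. One nonzero vector from each
  line gives a basis of \<open>hom_values\<close> of the whole space.
\<close>

theorem card_isomorphic_summands:
  fixes V :: "'v::real_vector set"
  assumes S: "irreducible_rep G S U" and e: "e \<in> S" "e \<noteq> 0"
    and scalar: "\<And>f. equivariant G S U S U f \<Longrightarrow> f e \<in> span {e}"
    and dec: "irreducible_decomposition G V T \<W>"
  shows "card {W \<in> \<W>. rep_isomorphic G S U W T} = dim (hom_values G S U e V T)"
proof -
  have repS: "representation G S U"
    using S by (simp add: irreducible_rep_def)
  have \<W>: "finite \<W>" "\<And>W. W \<in> \<W> \<Longrightarrow> irreducible_rep G W T"
      "independent_family \<W> (\<lambda>W. W)" "subspace_sum \<W> (\<lambda>W. W) = V"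
    using dec by (auto simp: irreducible_decomposition_def)
  have rep: "representation G W T" if "W \<in> \<W>" for W
    using \<W>(2)[OF that] by (simp add: irreducible_rep_def)
  have sub: "subspace W" if "W \<in> \<W>" for W
    using rep[OF that] by (rule representationD)
  have sub_V: "W \<subseteq> V" if "W \<in> \<W>" for W
    using summand_subset_subspace_sum[OF \<W>(1), of "\<lambda>W. W"] sub that \<W>(4) by blast
  define \<W>S where "\<W>S = {W \<in> \<W>. rep_isomorphic G S U W T}"
  have "\<forall>W\<in>\<W>S. \<exists>\<phi>. equivariant G S U W T \<phi> \<and> bij_betw \<phi> S W"
    by (auto simp: \<W>S_def rep_isomorphic_iff_equivariant)
  then obtain \<phi> where \<phi>: "\<And>W. W \<in> \<W>S \<Longrightarrow> equivariant G S U W T (\<phi> W)"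
      "\<And>W. W \<in> \<W>S \<Longrightarrow> bij_betw (\<phi> W) S W"
    by metis
  define x where "x W = \<phi> W e" for W
  have xW: "x W \<in> W" "W \<in> \<W>" "x W \<noteq> 0" if "W \<in> \<W>S" for W
  proof -
    show "x W \<in> W"
      using equivariantD(2)[OF \<phi>(1)[OF that] e(1)] by (simp add: x_def)
    show "W \<in> \<W>"
      using that by (simp add: \<W>S_def)
    have "\<phi> W e \<noteq> \<phi> W 0"
      using \<phi>(2)[OF that] e representationD(2)[OF repS]
      by (metis bij_betw_imp_inj_on inj_onD subspace_0)
    then show "x W \<noteq> 0"
      using linear_0[OF equivariantD(1)[OF \<phi>(1)[OF that]]] by (simp add: x_def)
  qed
  have line: "f e \<in> span {x W}" if W: "W \<in> \<W>S" and f: "equivariant G S U W T f" for f W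
  proof -
    have "f e \<in> \<phi> W ` hom_values G S U e S U"
      using hom_values_isomorphic[OF repS \<phi>[OF W] e(1), of U] f by (auto simp: hom_values_def)
    then have "f e \<in> \<phi> W ` span {e}"
      using scalar by (auto simp: hom_values_def)
    then show ?thesis
      using linear_span_image[OF equivariantD(1)[OF \<phi>(1)[OF W]], of "{e}"] by (simp add: x_def)
  qed
  have zero: "f e = 0" if "W \<in> \<W> - \<W>S" "equivariant G S U W T f" for f W
  proof (rule ccontr)
    assume "f e \<noteq> 0"
    then have "bij_betw f S W"
      using Schur[OF S \<W>(2) that(2) e(1)] that(1) by blast
    then have "rep_isomorphic G S U W T"
      unfolding rep_isomorphic_iff_equivariant using repS rep that by blast
    then show False
      using that(1) by (simp add: \<W>S_def)
  qed
  have inj: "inj_on x \<W>S"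
  proof (rule inj_onI, rule ccontr)
    fix W X assume "W \<in> \<W>S" "X \<in> \<W>S" "x W = x X" "W \<noteq> X"
    then show False
      using independent_family_summands_disjoint[OF \<W>(3,1) sub, of W X "x W"] xW[of W] xW[of X]
      by simp
  qed
  have "independent (x ` \<W>S)"
  proof (rule independent_if_scalars_zero)
    fix c y assume c: "(\<Sum>y\<in>x ` \<W>S. c y *\<^sub>R y) = 0" and "y \<in> x ` \<W>S"
    then obtain W where W: "W \<in> \<W>S" "y = x W"
      by blast
    define f where "f W = (if W \<in> \<W>S then c (x W) *\<^sub>R x W else 0)" for W
    have "(\<Sum>W\<in>\<W>. f W) = (\<Sum>W\<in>\<W>S. c (x W) *\<^sub>R x W)"
      unfolding f_def using \<W>(1) xW(2) by (intro sum.mono_neutral_cong_right) auto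
    also have "\<dots> = 0"
      using c inj by (simp add: sum.reindex)
    finally have "f W = 0"
      using independent_familyD[OF \<W>(3), of f W] xW W sub
      by (auto simp: f_def subspace_0 subspace_scale)
    then show "c y = 0"
      using W xW by (simp add: f_def)
  qed (use \<W>(1) in \<open>auto simp: \<W>S_def\<close>)
  moreover have "x ` \<W>S \<subseteq> hom_values G S U e V T"
  proof clarify
    fix W assume W: "W \<in> \<W>S"
    then have "equivariant G S U V T (\<phi> W)"
      using \<phi>(1)[OF W] sub_V[OF xW(2)[OF W]] unfolding equivariant_def by blast
    then show "x W \<in> hom_values G S U e V T"
      unfolding hom_values_def x_def by blast
  qed
  moreover have "hom_values G S U e V T \<subseteq> span (x ` \<W>S)"
  proof
    fix v assume "v \<in> hom_values G S U e V T"
    then obtain f where f: "equivariant G S U V T f" "v = f e"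
      by (auto simp: hom_values_def)
    obtain p where p: "\<And>W. W \<in> \<W> \<Longrightarrow> linear (p W)"
        "\<And>W h. W \<in> \<W> \<Longrightarrow> (\<And>X. X \<in> \<W> \<Longrightarrow> h X \<in> X) \<Longrightarrow> p W (\<Sum>X\<in>\<W>. h X) = h W"
      using summand_projections_exist[OF \<W>(3,1) sub] by metis
    have equi: "equivariant G V T W T (p W)" if W: "W \<in> \<W>" for W
    proof -
      have "p W y \<in> W \<and> p W (T g y) = T g (p W y)" if y: "y \<in> V" and g: "g \<in> carrier G" for g y
      proof -
        obtain h where h: "\<And>X. X \<in> \<W> \<Longrightarrow> h X \<in> X" "y = (\<Sum>X\<in>\<W>. h X)"
          using y \<W>(4) by (metis subspace_sumE)
        have "T g y = (\<Sum>X\<in>\<W>. T g (h X))"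
          unfolding h(2) by (rule linear_sum[OF representationD(3)[OF rep[OF W] g]])
        then have "p W (T g y) = T g (h W)"
          using p(2)[OF W, of "\<lambda>X. T g (h X)"] h(1) representationD(4)[OF rep _ _] g by simp
        then show ?thesis
          using p(2)[OF W h(1)] h W by simp
      qed
      moreover have "\<one>\<^bsub>G\<^esub> \<in> carrier G"
        using representationD(1)[OF repS] by (simp add: group.is_monoid)
      ultimately show ?thesis
        using p(1)[OF W] by (auto simp: equivariant_def)
    qed
    obtain h where h: "\<And>X. X \<in> \<W> \<Longrightarrow> h X \<in> X" "f e = (\<Sum>X\<in>\<W>. h X)"
      using equivariantD(2)[OF f(1) e(1)] \<W>(4) by (metis subspace_sumE)
    have "h W \<in> span (x ` \<W>S)" if W: "W \<in> \<W>" for W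
    proof -
      have pf: "equivariant G S U W T (p W \<circ> f)" "(p W \<circ> f) e = h W"
        using equivariant_compose[OF f(1) equi[OF W]] p(2)[OF W h(1)] h(2) by auto
      show ?thesis
      proof (cases "W \<in> \<W>S")
        case True
        then have "h W \<in> span {x W}"
          using line[OF True pf(1)] pf(2) by simp
        then show ?thesis
          using span_mono[of "{x W}" "x ` \<W>S"] True by blast
      next
        case False
        then have "h W = 0"
          using zero[OF _ pf(1)] pf(2) W by auto
        then show ?thesis
          by (simp add: span_zero)
      qed
    qed
    then show "v \<in> span (x ` \<W>S)"
      using h(2) f(2) by (simp add: span_sum)
  qed
  ultimately have "card (x ` \<W>S) = dim (hom_values G S U e V T)"
    by (intro basis_card_eq_dim)
  then show ?thesis
    using card_image[OF inj] by (simp add: \<W>S_def)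
qed

text \<open>
  The dimension does not mention the decomposition, so all decompositions give the same number and
  the definite description in the definition of the multiplicity denotes it.
\<close>

corollary multiplicity_rep_eq_card:
  assumes "irreducible_rep G S U" "e \<in> S" "e \<noteq> 0"
    and "\<And>f. equivariant G S U S U f \<Longrightarrow> f e \<in> span {e}"
    and "irreducible_decomposition G V T \<W>"
  shows "multiplicity_rep G S U V T = card {W \<in> \<W>. rep_isomorphic G S U W T}"
proof -
  have card: "card {W \<in> \<W>. rep_isomorphic G S U W T} = dim (hom_values G S U e V T)"
    if "irreducible_decomposition G V T \<W>" for \<W>
    by (rule card_isomorphic_summands[OF assms(1-3) _ that]) (rule assms(4))
  have "multiplicity_rep G S U V T = (THE m. \<exists>\<W>. irreducible_decomposition G V T \<W> \<and>
      card {W \<in> \<W>. rep_isomorphic G S U W T} = m)"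
    unfolding multiplicity_rep_def irreducible_decomposition_def by (simp add: conj_assoc)
  also have "\<dots> = card {W \<in> \<W>. rep_isomorphic G S U W T}"
    using assms(5) card by (intro the_equality) auto
  finally show ?thesis .
qed

text \<open>
  Frobenius reciprocity: an equivariant map \<open>f\<close> into the regular representation is determined by the
  linear form \<open>l s = f s \<one>\<close>, via \<open>f s g = l (U g s)\<close>, and every linear form on \<open>S\<close> arises. The forms
  dual to a basis of \<open>S\<close> chosen inside the orbit of \<open>e\<close> have independent values \<open>f e\<close>, because these
  are functions on the group that are told apart by evaluating them at group elements.
\<close>

theorem dim_hom_values_regular:
  fixes G (structure)
  assumes S: "representation G S U" and e: "e \<in> S" "S = span ((\<lambda>g. U g e) ` carrier G)"
    and fin: "finite (carrier G)"
    and T: "\<And>g h F. g \<in> carrier G \<Longrightarrow> T g F h = F (h \<otimes> g)"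
    and T0: "\<And>g h F. g \<in> carrier G \<Longrightarrow> F \<in> L_space (carrier G) \<Longrightarrow> T g F \<in> L_space (carrier G)"
  shows "dim (hom_values G S U e (L_space (carrier G)) T) = dim S"
proof -
  note S' = representationD[OF S]
  interpret group G by (rule S'(1))
  let ?O = "(\<lambda>g. U g e) ` carrier G"
  obtain B where B: "B \<subseteq> ?O" "independent B" "?O \<subseteq> span B"
    using maximal_independent_subset by blast
  have BS: "B \<subseteq> S" "S \<subseteq> span B"
    using B(1,3) e(2) span_base[of _ ?O] span_minimal[OF B(3)] by auto
  have finB: "finite B"
    using B(1) fin by (rule finite_surj[rotated])
  have "\<exists>l::_ \<Rightarrow> real. linear l \<and> (\<forall>c\<in>B. l c = (if c = b then 1 else 0))" for b
    by (rule linear_independent_extend[OF B(2)])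
  then obtain l :: "_ \<Rightarrow> _ \<Rightarrow> real" where l: "\<And>b. linear (l b)"
      "\<And>b c. c \<in> B \<Longrightarrow> l b c = (if c = b then 1 else 0)"
    by metis
  define f where "f b s g = (if g \<in> carrier G then l b (U g s) else 0)" for b s g
  have f: "equivariant G S U (L_space (carrier G)) T (f b)" for b
  proof -
    have "linear (f b)"
      using S'(3) l(1)
      by (intro linearI) (auto simp: f_def fun_eq_iff linear_add linear_scale)
    moreover have "f b s \<in> L_space (carrier G)" for s
      by (simp add: L_space_def f_def)
    moreover have "f b (U g s) = T g (f b s)" if g: "g \<in> carrier G" and s: "s \<in> S" for g s
    proof
      fix h
      show "f b (U g s) h = T g (f b s) h"
      proof (cases "h \<in> carrier G")
        case True
        then show ?thesis
          using g s S'(6) T[OF g] by (simp add: f_def)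
      next
        case False
        then show ?thesis
          using T0[OF g \<open>f b s \<in> L_space (carrier G)\<close>] by (simp add: f_def L_space_def)
      qed
    qed
    ultimately show ?thesis
      by (auto simp: equivariant_def)
  qed
  define x where "x b = f b e" for b
  have x_at: "x b g = (if c = b then 1 else 0)" if "g \<in> carrier G" "U g e = c" "c \<in> B" for b c g
    using that l(2) by (simp add: x_def f_def)
  have inj: "inj_on x B"
  proof (rule inj_onI)
    fix b c assume bc: "b \<in> B" "c \<in> B" "x b = x c"
    obtain g where g: "g \<in> carrier G" "U g e = c"
      using bc(2) B(1) by blast
    have "x b g = 1"
      unfolding bc(3) using x_at[OF g bc(2), of c] by simp
    then show "b = c"
      using x_at[OF g bc(2), of b] by (simp split: if_splits)
  qed
  have "independent (x ` B)"
  proof (rule independent_if_scalars_zero)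
    fix a y assume a: "(\<Sum>y\<in>x ` B. a y *\<^sub>R y) = 0" and "y \<in> x ` B"
    then obtain c where c: "c \<in> B" "y = x c"
      by blast
    obtain g where g: "g \<in> carrier G" "U g e = c"
      using c(1) B(1) by blast
    have "0 = (\<Sum>b\<in>B. a (x b) *\<^sub>R x b) g"
      using a inj by (simp add: sum.reindex)
    also have "\<dots> = (\<Sum>b\<in>B. if c = b then a (x b) else 0)"
      using x_at[OF g c(1)] by (auto simp: sum_fun_apply intro!: sum.cong)
    also have "\<dots> = a y"
      using c finB by simp
    finally show "a y = 0" by simp
  qed (use finB in auto)
  moreover have "x ` B \<subseteq> hom_values G S U e (L_space (carrier G)) T"
    using f by (auto simp: hom_values_def x_def)
  moreover have "hom_values G S U e (L_space (carrier G)) T \<subseteq> span (x ` B)"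
  proof
    fix v assume "v \<in> hom_values G S U e (L_space (carrier G)) T"
    then obtain h where h: "equivariant G S U (L_space (carrier G)) T h" "v = h e"
      by (auto simp: hom_values_def)
    note h1 = equivariantD[OF h(1)]
    define k where "k s = h s \<one>" for s
    have k: "linear k"
      using h1(1) by (intro linearI) (auto simp: k_def linear_add linear_scale)
    have k_eq: "k s = (\<Sum>b\<in>B. k b * l b s)" if "s \<in> span B" for s
    proof (rule linear_eq_on[OF k _ that])
      show "linear (\<lambda>s. \<Sum>b\<in>B. k b * l b s)"
        using l(1) by (intro linear_compose_sum ballI linearI)
          (auto simp: linear_add linear_scale algebra_simps)
      show "k c = (\<Sum>b\<in>B. k b * l b c)" if "c \<in> B" for c
      proof -
        have "(\<Sum>b\<in>B. k b * l b c) = (\<Sum>b\<in>B. if c = b then k c else 0)"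
          using l(2)[OF that] by (intro sum.cong) auto
        then show ?thesis
          using that finB by simp
      qed
    qed
    have "v = (\<Sum>b\<in>B. k b *\<^sub>R x b)"
    proof
      fix g
      show "v g = (\<Sum>b\<in>B. k b *\<^sub>R x b) g"
      proof (cases "g \<in> carrier G")
        case True
        have "v g = T g (h e) \<one>"
          using T[OF True] True h(2) by simp
        also have "\<dots> = k (U g e)"
          using h1(3)[OF True e(1)] by (simp add: k_def)
        also have "\<dots> = (\<Sum>b\<in>B. k b * l b (U g e))"
          using k_eq BS(2) S'(4)[OF True e(1)] by blast
        finally show ?thesis
          using True by (simp add: sum_fun_apply x_def f_def)
      next
        case False
        then show ?thesis
          using h1(2)[OF e(1)] h(2) by (simp add: sum_fun_apply x_def f_def L_space_def)
      qed
    qed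
    then show "v \<in> span (x ` B)"
      by (auto intro: span_sum span_scale span_base)
  qed
  ultimately have "card (x ` B) = dim (hom_values G S U e (L_space (carrier G)) T)"
    by (intro basis_card_eq_dim)
  then show ?thesis
    using card_image[OF inj] basis_card_eq_dim[OF BS(1,2) B(2)] by simp
qed

section \<open>Marginals of injective words\<close>

lemma finite_\<Gamma>: "finite A \<Longrightarrow> finite (\<Gamma> A)"
  using finite_subset_distinct[of A] by (rule finite_subset[rotated]) (auto simp: \<Gamma>_def)

lemma finite_\<Gamma>\<^sub>n: "finite (\<Gamma>\<^sub>n n)"
  unfolding \<Gamma>\<^sub>n_def
  by (intro finite_UN_I finite_subset[of "\<P> {1..n}" "Pow {1..n}"] finite_\<Gamma>)
    (auto simp: \<P>_def intro: finite_subset)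

lemma finite_\<Gamma>bar: "finite (\<Gamma>bar n)"
  by (simp add: \<Gamma>bar_def finite_\<Gamma>\<^sub>n)

lemma \<Gamma>_subset_\<Gamma>bar: "B \<in> \<P>bar {1..n} \<Longrightarrow> \<Gamma> B \<subseteq> \<Gamma>bar n"
  by (auto simp: \<P>bar_def \<Gamma>bar_def \<Gamma>\<^sub>n_def \<Gamma>_def)

lemma subseq_iff_filter:
  assumes "\<pi> \<in> \<Gamma> A" "distinct \<sigma>"
  shows "subseq \<pi> \<sigma> \<longleftrightarrow> filter (\<lambda>x. x \<in> A) \<sigma> = \<pi>"
proof
  assume sub: "subseq \<pi> \<sigma>"
  have \<pi>: "distinct \<pi>" "set \<pi> = A"
    using assms(1) by (auto simp: \<Gamma>_def)
  have "subseq (filter (\<lambda>x. x \<in> A) \<pi>) (filter (\<lambda>x. x \<in> A) \<sigma>)"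
    using sub by simp
  moreover have "filter (\<lambda>x. x \<in> A) \<pi> = \<pi>"
    using \<pi> by (simp add: filter_id_conv)
  moreover have "set (filter (\<lambda>x. x \<in> A) \<sigma>) = set \<pi>"
    using \<pi>(2) list_emb_set[OF sub] by auto
  then have "length \<pi> = length (filter (\<lambda>x. x \<in> A) \<sigma>)"
    using \<pi>(1) assms(2) by (metis distinct_card distinct_filter)
  ultimately show "filter (\<lambda>x. x \<in> A) \<sigma> = \<pi>"
    using subseq_same_length by metis
next
  assume "filter (\<lambda>x. x \<in> A) \<sigma> = \<pi>"
  then show "subseq \<pi> \<sigma>"
    using subseq_filter_left by metis
qed

text \<open>
  The marginal on \<open>C\<close> of a function on \<open>\<Gamma> B\<close>, without a special case for small \<open>C\<close>. An injective
  word with content \<open>B\<close> has exactly one subword with content \<open>B \<inter> C\<close>, obtained by deleting the other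
  letters, so that summing over superwords is summing over the fibres of a map.
\<close>

definition word_marginal :: "nat set \<Rightarrow> nat set \<Rightarrow> (nat list \<Rightarrow> real) \<Rightarrow> nat list \<Rightarrow> real"
  where "word_marginal B C F \<tau> = (\<Sum>\<sigma> | \<sigma> \<in> \<Gamma> B \<and> filter (\<lambda>x. x \<in> C) \<sigma> = \<tau>. F \<sigma>)"

lemma word_marginal_sum:
  "word_marginal B C (\<Sum>i\<in>I. F i) \<tau> = (\<Sum>i\<in>I. word_marginal B C (F i) \<tau>)"
  unfolding word_marginal_def by (simp add: sum_fun_apply sum.swap[of _ I])

lemma word_marginal_diff:
  "word_marginal B C (F - H) \<tau> = word_marginal B C F \<tau> - word_marginal B C H \<tau>"
  by (simp add: word_marginal_def sum_subtractf)

lemma word_marginal_outside: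
  assumes "\<tau> \<notin> \<Gamma> (B \<inter> C)"
  shows "word_marginal B C F \<tau> = 0"
proof -
  have none: "{\<sigma>. \<sigma> \<in> \<Gamma> B \<and> filter (\<lambda>x. x \<in> C) \<sigma> = \<tau>} = {}"
    using assms by (auto simp: \<Gamma>_def)
  show ?thesis
    unfolding word_marginal_def none by simp
qed

lemma word_marginal_self: "\<sigma> \<in> \<Gamma> B \<Longrightarrow> word_marginal B B F \<sigma> = F \<sigma>"
proof -
  assume "\<sigma> \<in> \<Gamma> B"
  moreover have "filter (\<lambda>x. x \<in> B) \<rho> = \<rho>" if "\<rho> \<in> \<Gamma> B" for \<rho>
    using that by (auto simp: \<Gamma>_def filter_id_conv)
  ultimately have "{\<rho>. \<rho> \<in> \<Gamma> B \<and> filter (\<lambda>x. x \<in> B) \<rho> = \<sigma>} = {\<sigma>}"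
    by auto
  then show ?thesis
    by (simp add: word_marginal_def)
qed

text \<open>
  Words with at most one letter are determined by their content. So the marginals on small sets carry
  the same information, namely the total sum.
\<close>

lemma word_marginal_small:
  assumes C: "C \<subseteq> B" "finite C" "card C \<le> 1"
  obtains \<tau>0 where "\<And>F \<tau>. word_marginal B C F \<tau> = (if \<tau> = \<tau>0 then sum F (\<Gamma> B) else 0)"
proof -
  obtain \<tau>0 where \<tau>0: "\<Gamma> C = {\<tau>0}"
  proof (cases "C = {}")
    case True
    then have "\<Gamma> C = {[]}"
      by (auto simp: \<Gamma>_def)
    then show ?thesis ..
  next
    case False
    then have "card C = 1"
      using C by (simp add: le_Suc_eq)
    then obtain c where c: "C = {c}"
      by (rule card_1_singletonE)
    have "\<pi> = [c]" if "distinct \<pi>" "set \<pi> = {c}" for \<pi> :: "nat list"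
      using that by (cases \<pi>; cases "tl \<pi>") auto
    then have "\<Gamma> C = {[c]}"
      using c by (auto simp: \<Gamma>_def)
    then show ?thesis ..
  qed
  have "filter (\<lambda>x. x \<in> C) \<sigma> = \<tau>0" if "\<sigma> \<in> \<Gamma> B" for \<sigma>
  proof -
    have "filter (\<lambda>x. x \<in> C) \<sigma> \<in> \<Gamma> C"
      using that C(1) by (auto simp: \<Gamma>_def)
    then show ?thesis
      using \<tau>0 by simp
  qed
  then have "{\<sigma>. \<sigma> \<in> \<Gamma> B \<and> filter (\<lambda>x. x \<in> C) \<sigma> = \<tau>} = (if \<tau> = \<tau>0 then \<Gamma> B else {})" for \<tau>
    by auto
  then show ?thesis
    by (intro that[of \<tau>0]) (simp add: word_marginal_def)
qed

text \<open>Deleting letters in two steps: group the words of \<open>\<Gamma> E\<close> by what is left after the first.\<close>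

lemma word_marginal_word_marginal:
  assumes "finite E" "B \<subseteq> E" "C \<subseteq> B"
  shows "word_marginal B C (word_marginal E B F) \<tau> = word_marginal E C F \<tau>"
proof -
  let ?S = "{\<sigma>. \<sigma> \<in> \<Gamma> E \<and> filter (\<lambda>x. x \<in> C) \<sigma> = \<tau>}"
    and ?T = "{\<rho>. \<rho> \<in> \<Gamma> B \<and> filter (\<lambda>x. x \<in> C) \<rho> = \<tau>}"
  have fil: "filter (\<lambda>x. x \<in> C) (filter (\<lambda>x. x \<in> B) \<sigma>) = filter (\<lambda>x. x \<in> C) \<sigma>" for \<sigma>
    using assms(3) by (auto intro: filter_cong)
  have "finite ?S" "finite ?T"
    using finite_\<Gamma>[OF assms(1)] finite_\<Gamma>[OF finite_subset[OF assms(2,1)]] by auto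
  moreover have "filter (\<lambda>x. x \<in> B) ` ?S \<subseteq> ?T"
    using assms(2) fil by (auto simp: \<Gamma>_def)
  ultimately have "(\<Sum>\<rho>\<in>?T. \<Sum>\<sigma> | \<sigma> \<in> ?S \<and> filter (\<lambda>x. x \<in> B) \<sigma> = \<rho>. F \<sigma>) = sum F ?S"
    by (rule sum.group)
  moreover have "{\<sigma>. \<sigma> \<in> ?S \<and> filter (\<lambda>x. x \<in> B) \<sigma> = \<rho>} = {\<sigma>. \<sigma> \<in> \<Gamma> E \<and> filter (\<lambda>x. x \<in> B) \<sigma> = \<rho>}"
    if "\<rho> \<in> ?T" for \<rho>
    using that fil by auto
  ultimately show ?thesis
    by (simp add: word_marginal_def)
qed

text \<open>
  On singletons, \<open>marginal\<close> and \<open>word_marginal\<close> differ by the word that carries the total sum; they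
  vanish simultaneously, which is all that the spaces \<open>H_space n B\<close> depend on.
\<close>

lemma marginal_eq_0_iff:
  assumes B: "B \<in> \<P> {1..n}" and F: "F \<in> L_space (\<Gamma> B)" and C: "C \<subseteq> B"
  shows "marginal n C F = 0 \<longleftrightarrow> (\<forall>\<tau>. word_marginal B C F \<tau> = 0)"
proof (cases "card C \<le> 1")
  case True
  have fin: "finite C"
    using B C by (auto simp: \<P>_def intro: finite_subset)
  have "sum F (\<Gamma>bar n) = sum F (\<Gamma> B)"
    using B F \<Gamma>_subset_\<Gamma>bar[of B n]
    by (intro sum.mono_neutral_right finite_\<Gamma>bar) (auto simp: \<P>bar_def L_space_def)
  moreover have "dirac ([] :: nat list) [] = 1"
    by (simp add: dirac_def)
  then have "dirac [] \<noteq> (0 :: nat list \<Rightarrow> real)"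
    by auto
  ultimately have "marginal n C F = 0 \<longleftrightarrow> sum F (\<Gamma> B) = 0"
    using True by (simp add: marginal_def)
  also have "\<dots> \<longleftrightarrow> (\<forall>\<tau>. word_marginal B C F \<tau> = 0)"
    by (rule word_marginal_small[OF C fin True]) auto
  finally show ?thesis .
next
  case False
  have "marginal n C F \<tau> = word_marginal B C F \<tau>" for \<tau>
  proof (cases "\<tau> \<in> \<Gamma> C")
    case True
    have "marginal n C F \<tau> = (\<Sum>\<sigma> | \<sigma> \<in> \<Gamma>\<^sub>n n \<and> subseq \<tau> \<sigma>. F \<sigma>)"
      using \<open>\<not> card C \<le> 1\<close> True by (simp add: marginal_def)
    also have "\<dots> = (\<Sum>\<sigma> | \<sigma> \<in> \<Gamma> B \<and> filter (\<lambda>x. x \<in> C) \<sigma> = \<tau>. F \<sigma>)"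
    proof (rule sum.mono_neutral_right)
      show "finite {\<sigma>. \<sigma> \<in> \<Gamma>\<^sub>n n \<and> subseq \<tau> \<sigma>}"
        using finite_\<Gamma>\<^sub>n by simp
      show "{\<sigma>. \<sigma> \<in> \<Gamma> B \<and> filter (\<lambda>x. x \<in> C) \<sigma> = \<tau>} \<subseteq> {\<sigma>. \<sigma> \<in> \<Gamma>\<^sub>n n \<and> subseq \<tau> \<sigma>}"
        using B by (auto simp: \<Gamma>\<^sub>n_def)
      show "\<forall>\<sigma>\<in>{\<sigma>. \<sigma> \<in> \<Gamma>\<^sub>n n \<and> subseq \<tau> \<sigma>} - {\<sigma>. \<sigma> \<in> \<Gamma> B \<and> filter (\<lambda>x. x \<in> C) \<sigma> = \<tau>}. F \<sigma> = 0"
        using F subseq_iff_filter[OF True] by (auto simp: L_space_def \<Gamma>_def)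
    qed
    finally show ?thesis
      by (simp add: word_marginal_def)
  next
    case False
    then show ?thesis
      using \<open>\<not> card C \<le> 1\<close> word_marginal_outside[of \<tau> B C F] C
      by (simp add: marginal_def Int_absorb1)
  qed
  then show ?thesis
    by (simp add: fun_eq_iff)
qed

lemma H_space_iff:
  assumes "B \<in> \<P>bar {1..n}"
  shows "F \<in> H_space n B \<longleftrightarrow>
    F \<in> L_space (\<Gamma> B) \<and> (\<forall>C \<tau>. C \<subset> B \<longrightarrow> word_marginal B C F \<tau> = 0)"
proof (cases "B = {}")
  case False
  then have B: "B \<in> \<P> {1..n}"
    using assms by (simp add: \<P>bar_def)
  show ?thesis
    using False marginal_eq_0_iff[OF B] by (auto simp: H_space_def)
qed (auto simp: H_space_def)

lemma subspace_H_space: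
  assumes "B \<in> \<P>bar {1..n}"
  shows "subspace (H_space n B)"
  using subspace_L_space[of "\<Gamma> B"] assms
  by (auto simp: subspace_def H_space_iff word_marginal_def sum.distrib sum_distrib_left[symmetric])

section \<open>Wavelet synthesis\<close>

text \<open>
  Contiguous subwords are recorded with their position. An empty middle piece is thus counted once for
  each position, so that content \<open>{}\<close> follows the same counting rule as every other content.
\<close>

definition windows :: "nat list \<Rightarrow> (nat list \<times> nat list \<times> nat list) set"
  where "windows \<sigma> = {(a, \<pi>, b). a @ \<pi> @ b = \<sigma>}"

lemma finite_windows: "finite (windows \<sigma>)"
proof (rule finite_subset)
  let ?f = "\<lambda>(i, j). (take i \<sigma>, take j (drop i \<sigma>), drop (i + j) \<sigma>)"
  show "windows \<sigma> \<subseteq> ?f ` ({..length \<sigma>} \<times> {..length \<sigma>})"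
  proof
    fix w assume "w \<in> windows \<sigma>"
    then obtain a \<pi> b where "w = (a, \<pi>, b)" "\<sigma> = a @ \<pi> @ b"
      by (auto simp: windows_def)
    then show "w \<in> ?f ` ({..length \<sigma>} \<times> {..length \<sigma>})"
      by (intro image_eqI[of _ _ "(length a, length \<pi>)"]) auto
  qed
qed auto

definition synthesis :: "nat set \<Rightarrow> (nat list \<Rightarrow> real) \<Rightarrow> nat list \<Rightarrow> real"
  where "synthesis E F \<sigma> = (if \<sigma> \<in> \<Gamma> E then \<Sum>(a, \<pi>, b)\<in>windows \<sigma>. F \<pi> else 0)"

lemma linear_synthesis: "linear (synthesis E)"
  by (rule linearI)
    (auto simp: synthesis_def fun_eq_iff sum.distrib sum_distrib_left case_prod_unfold)

lemma synthesis_in_L_space: "synthesis E F \<in> L_space (\<Gamma> E)"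
  by (simp add: synthesis_def L_space_def)

text \<open>The surroundings \<open>a\<close>, \<open>b\<close> that complete every word with content \<open>B\<close> to one with content \<open>E\<close>.\<close>

definition frames :: "nat set \<Rightarrow> nat set \<Rightarrow> (nat list \<times> nat list) set"
  where "frames E B = {(a, b). a @ b \<in> \<Gamma> (E - B)}"

lemma finite_frames:
  assumes "finite E"
  shows "finite (frames E B)"
proof (rule finite_subset)
  show "frames E B \<subseteq> {xs. set xs \<subseteq> E \<and> distinct xs} \<times> {xs. set xs \<subseteq> E \<and> distinct xs}"
    by (auto simp: frames_def \<Gamma>_def)
qed (use finite_subset_distinct[OF assms] in auto)

lemma frames_nonempty:
  assumes "finite E"
  shows "frames E B \<noteq> {}"
proof -
  obtain xs where "set xs = E - B" "distinct xs"
    using finite_distinct_list[of "E - B"] assms by auto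
  then have "([], xs) \<in> frames E B"
    by (simp add: frames_def \<Gamma>_def)
  then show ?thesis by blast
qed

text \<open>
  A pair of a word with content \<open>E\<close> and a window in it with content \<open>B\<close> is the same as a frame
  together with a word with content \<open>B\<close>.
\<close>

lemma word_marginal_synthesis:
  assumes E: "finite E" and B: "B \<subseteq> E" and F: "F \<in> L_space (\<Gamma> B)"
  shows "word_marginal E C (synthesis E F) \<tau> =
    (\<Sum>(a, b)\<in>frames E B. \<Sum>\<pi> | \<pi> \<in> \<Gamma> B \<and> filter (\<lambda>x. x \<in> C) (a @ \<pi> @ b) = \<tau>. F \<pi>)"
proof -
  let ?X = "{\<sigma>. \<sigma> \<in> \<Gamma> E \<and> filter (\<lambda>x. x \<in> C) \<sigma> = \<tau>}"
    and ?W = "\<lambda>\<sigma>. {w \<in> windows \<sigma>. fst (snd w) \<in> \<Gamma> B}"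
    and ?Y = "\<lambda>c. {\<pi>. \<pi> \<in> \<Gamma> B \<and> filter (\<lambda>x. x \<in> C) (fst c @ \<pi> @ snd c) = \<tau>}"
  have "word_marginal E C (synthesis E F) \<tau> = (\<Sum>\<sigma>\<in>?X. \<Sum>w\<in>windows \<sigma>. F (fst (snd w)))"
    unfolding word_marginal_def by (intro sum.cong) (auto simp: synthesis_def case_prod_unfold)
  also have "\<dots> = (\<Sum>\<sigma>\<in>?X. \<Sum>w\<in>?W \<sigma>. F (fst (snd w)))"
    using F finite_windows by (intro sum.cong sum.mono_neutral_right) (auto simp: L_space_def)
  also have "\<dots> = (\<Sum>(\<sigma>, w)\<in>Sigma ?X ?W. F (fst (snd w)))"
    using finite_\<Gamma>[OF E] finite_windows by (intro sum.Sigma) auto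
  also have "\<dots> = (\<Sum>(c, \<pi>)\<in>Sigma (frames E B) ?Y. F \<pi>)"
    by (rule sum.reindex_bij_witness[of _
          "\<lambda>(c, \<pi>). (fst c @ \<pi> @ snd c, (fst c, \<pi>, snd c))" "\<lambda>(\<sigma>, (a, \<pi>, b)). ((a, b), \<pi>)"])
      (use B in \<open>auto simp: windows_def frames_def \<Gamma>_def\<close>)
  also have "\<dots> = (\<Sum>c\<in>frames E B. \<Sum>\<pi>\<in>?Y c. F \<pi>)"
    using finite_frames[OF E] finite_\<Gamma>[OF finite_subset[OF B E]]
    by (intro sum.Sigma[symmetric]) auto
  finally show ?thesis
    by (simp add: case_prod_unfold)
qed

text \<open>
  Within a fixed frame, prescribing the \<open>C\<close>-letters of the whole word amounts to prescribing those of
  the middle piece, so that each nonempty inner sum is a marginal on \<open>B \<inter> C\<close>, a proper subset of \<open>B\<close>.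
\<close>

lemma word_marginal_synthesis_eq_0:
  assumes B: "B \<in> \<P>bar {1..n}" and F: "F \<in> H_space n B" and C: "\<not> B \<subseteq> C"
  shows "word_marginal {1..n} C (synthesis {1..n} F) \<tau> = 0"
proof -
  have F': "F \<in> L_space (\<Gamma> B)" "\<And>D \<rho>. D \<subset> B \<Longrightarrow> word_marginal B D F \<rho> = 0"
    using F H_space_iff[OF B] by auto
  have "(\<Sum>\<pi> | \<pi> \<in> \<Gamma> B \<and> filter (\<lambda>x. x \<in> C) (a @ \<pi> @ b) = \<tau>. F \<pi>) = 0" (is "sum F ?Z = 0") for a b
  proof (cases "?Z = {}")
    case False
    then obtain \<pi>0 where \<pi>0: "\<pi>0 \<in> ?Z" by blast
    have "filter (\<lambda>x. x \<in> C) \<pi> = filter (\<lambda>x. x \<in> B \<inter> C) \<pi>" if "\<pi> \<in> \<Gamma> B" for \<pi>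
      using that by (auto simp: \<Gamma>_def intro: filter_cong)
    then have "?Z = {\<pi>. \<pi> \<in> \<Gamma> B \<and> filter (\<lambda>x. x \<in> B \<inter> C) \<pi> = filter (\<lambda>x. x \<in> C) \<pi>0}"
      using \<pi>0 by auto
    then have "sum F ?Z = word_marginal B (B \<inter> C) F (filter (\<lambda>x. x \<in> C) \<pi>0)"
      by (simp add: word_marginal_def)
    then show ?thesis
      using F'(2)[of "B \<inter> C"] C by auto
  qed (simp only: sum.empty)
  moreover have "B \<subseteq> {1..n}"
    using B by (auto simp: \<P>bar_def \<P>_def)
  ultimately show ?thesis
    using word_marginal_synthesis[OF _ _ F'(1)] by (simp add: case_prod_unfold)
qed

lemma word_marginal_synthesis_self:
  assumes E: "finite E" and B: "B \<subseteq> E" and F: "F \<in> L_space (\<Gamma> B)"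
  shows "word_marginal E B (synthesis E F) \<tau> = real (card (frames E B)) * F \<tau>"
proof -
  have "(\<Sum>\<pi> | \<pi> \<in> \<Gamma> B \<and> filter (\<lambda>x. x \<in> B) (a @ \<pi> @ b) = \<tau>. F \<pi>) = F \<tau>"
    if "(a, b) \<in> frames E B" for a b
  proof -
    have "filter (\<lambda>x. x \<in> B) (a @ \<pi> @ b) = \<pi>" if "\<pi> \<in> \<Gamma> B" for \<pi>
    proof -
      have "filter (\<lambda>x. x \<in> B) a = []" "filter (\<lambda>x. x \<in> B) b = []"
        using \<open>(a, b) \<in> frames E B\<close> by (auto simp: frames_def \<Gamma>_def filter_empty_conv)
      moreover have "filter (\<lambda>x. x \<in> B) \<pi> = \<pi>"
        using that by (auto simp: \<Gamma>_def filter_id_conv)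
      ultimately show ?thesis by simp
    qed
    then have eq: "{\<pi>. \<pi> \<in> \<Gamma> B \<and> filter (\<lambda>x. x \<in> B) (a @ \<pi> @ b) = \<tau>} = \<Gamma> B \<inter> {\<tau>}"
      by auto
    show ?thesis
      unfolding eq using F by (cases "\<tau> \<in> \<Gamma> B") (auto simp: L_space_def)
  qed
  then have "word_marginal E B (synthesis E F) \<tau> = (\<Sum>(a, b)\<in>frames E B. F \<tau>)"
    unfolding word_marginal_synthesis[OF E B F] by (intro sum.cong) auto
  then show ?thesis
    by (simp add: case_prod_unfold)
qed

lemma subspace_H_total: "subspace (H_total n)"
  unfolding H_total_def by (intro subspace_subspace_sum subspace_H_space)

text \<open>
  Induction on the size of \<open>C\<close>: only the summands with \<open>B \<subseteq> C\<close> contribute to the \<open>C\<close>-marginal of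
  the synthesis, and those with \<open>B \<subset> C\<close> are already known to be 0.
\<close>

lemma inj_on_synthesis: "inj_on (synthesis {1..n}) (H_total n)"
proof -
  let ?E = "{1..n}"
  have "F = 0" if F: "F \<in> H_total n" "synthesis ?E F = 0" for F
  proof -
    obtain f where f: "\<And>B. B \<in> \<P>bar ?E \<Longrightarrow> f B \<in> H_space n B" "F = (\<Sum>B\<in>\<P>bar ?E. f B)"
      using F(1) unfolding H_total_def by (rule subspace_sumE) blast
    have "f C = 0" if "C \<in> \<P>bar ?E" for C
      using that
    proof (induction "card C" arbitrary: C rule: less_induct)
      case less
      have C: "C \<subseteq> ?E"
        using less.prems by (auto simp: \<P>bar_def \<P>_def)
      have "f C \<tau> = 0" for \<tau>
      proof -
        have "0 = word_marginal ?E C (synthesis ?E F) \<tau>"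
          using \<open>synthesis ?E F = 0\<close> by (simp add: word_marginal_def)
        also have "\<dots> = (\<Sum>B\<in>\<P>bar ?E. word_marginal ?E C (synthesis ?E (f B)) \<tau>)"
          by (simp add: f(2) linear_sum[OF linear_synthesis] word_marginal_sum)
        also have "\<dots> = (\<Sum>B\<in>{C}. word_marginal ?E C (synthesis ?E (f B)) \<tau>)"
        proof (rule sum.mono_neutral_right)
          show "\<forall>B\<in>\<P>bar ?E - {C}. word_marginal ?E C (synthesis ?E (f B)) \<tau> = 0"
          proof
            fix B assume B: "B \<in> \<P>bar ?E - {C}"
            show "word_marginal ?E C (synthesis ?E (f B)) \<tau> = 0"
            proof (cases "B \<subseteq> C")
              case True
              then have "card B < card C"
                using B C finite_subset[OF C] by (intro psubset_card_mono) auto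
              then have "f B = 0"
                using less.hyps B by simp
              then show ?thesis
                by (simp add: word_marginal_def linear_0[OF linear_synthesis])
            next
              case False
              then show ?thesis
                using word_marginal_synthesis_eq_0[OF _ f(1)] B by blast
            qed
          qed
        qed (use less.prems finite_\<P>bar in auto)
        also have "\<dots> = real (card (frames ?E C)) * f C \<tau>"
          using word_marginal_synthesis_self[of ?E C "f C" \<tau>] C f(1)[OF less.prems]
            H_space_iff[OF less.prems] by simp
        finally show ?thesis
          using frames_nonempty[of ?E C] finite_frames[of ?E C] by simp
      qed
      then show ?case
        by (simp add: fun_eq_iff)
    qed
    then show "F = 0"
      using f(2) by simp
  qed
  then show ?thesis
    using linear_inj_on_iff_eq_0[OF linear_synthesis subspace_H_total] by blast
qed

text \<open>
  If all marginals of \<open>F\<close> on fewer than \<open>k\<close> letters vanish, then its marginals on \<open>k\<close> letters lie in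
  the spaces \<open>H_space n C\<close>, and subtracting their normalised syntheses makes them vanish, too.
\<close>

lemma L_space_subset_synthesis_image:
  "L_space (\<Gamma> {1..n}) \<subseteq> synthesis {1..n} ` H_total n"
proof
  let ?E = "{1..n}"
  have "F \<in> synthesis ?E ` H_total n"
    if "F \<in> L_space (\<Gamma> ?E)" "\<And>C \<tau>. C \<subseteq> ?E \<Longrightarrow> card C < k \<Longrightarrow> word_marginal ?E C F \<tau> = 0"
      "k \<le> Suc n" for F k
    using that(3,1,2)
  proof (induction k arbitrary: F rule: inc_induct)
    case base
    have "F \<sigma> = 0" for \<sigma>
      using base(1) base(2)[of ?E \<sigma>] word_marginal_self[of \<sigma> ?E F]
      by (cases "\<sigma> \<in> \<Gamma> ?E") (auto simp: L_space_def)
    then have "F = synthesis ?E 0"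
      by (simp add: linear_0[OF linear_synthesis] fun_eq_iff)
    then show ?case
      using subspace_0[OF subspace_H_total] by blast
  next
    case (step k)
    define h where "h C = (if card C = k then (1 / card (frames ?E C)) *\<^sub>R word_marginal ?E C F else 0)"
      for C
    define H where "H = (\<Sum>C\<in>\<P>bar ?E. h C)"
    have h: "h C \<in> H_space n C" if C: "C \<in> \<P>bar ?E" for C
    proof (cases "card C = k")
      case True
      have sub: "C \<subseteq> ?E"
        using C by (auto simp: \<P>bar_def \<P>_def)
      have "word_marginal ?E C F \<in> L_space (\<Gamma> C)"
        using word_marginal_outside[of _ ?E C F] sub by (simp add: L_space_def Int_absorb1)
      moreover have "word_marginal C D (word_marginal ?E C F) \<tau> = 0" if "D \<subset> C" for D \<tau>
        using word_marginal_word_marginal[of ?E C D F \<tau>] sub that True step.prems(2)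
          psubset_card_mono[OF finite_subset[OF sub] that] by auto
      ultimately have "word_marginal ?E C F \<in> H_space n C"
        using H_space_iff[OF C] by blast
      then show ?thesis
        using subspace_scale[OF subspace_H_space[OF C]] True by (simp add: h_def)
    qed (simp add: h_def subspace_0 subspace_H_space[OF C])
    have H: "H \<in> H_total n"
      unfolding H_total_def H_def using h by (rule subspace_sumI)
    have vanish: "word_marginal ?E C (F - synthesis ?E H) \<tau> = 0"
      if C: "C \<subseteq> ?E" "card C < Suc k" for C \<tau>
    proof -
      have fin: "finite C"
        using C(1) finite_subset by blast
      have other: "word_marginal ?E C (synthesis ?E (h B)) \<tau> = 0" if "B \<in> \<P>bar ?E" "B \<noteq> C" for B
      proof (cases "card B = k")
        case True
        then have "\<not> B \<subseteq> C"
          using that(2) C(2) card_seteq[OF fin, of B] by linarith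
        then show ?thesis
          using word_marginal_synthesis_eq_0[OF that(1) h[OF that(1)]] by simp
      qed (simp add: h_def word_marginal_def linear_0[OF linear_synthesis])
      have sum: "word_marginal ?E C (synthesis ?E H) \<tau> =
          (\<Sum>B\<in>\<P>bar ?E. word_marginal ?E C (synthesis ?E (h B)) \<tau>)"
        by (simp add: H_def linear_sum[OF linear_synthesis] word_marginal_sum)
      show ?thesis
      proof (cases "C \<in> \<P>bar ?E")
        case True
        then have "word_marginal ?E C (synthesis ?E H) \<tau> =
            (\<Sum>B\<in>{C}. word_marginal ?E C (synthesis ?E (h B)) \<tau>)"
          unfolding sum using other finite_\<P>bar by (intro sum.mono_neutral_right) auto
        also have "\<dots> = real (card (frames ?E C)) * h C \<tau>"
          using word_marginal_synthesis_self[of ?E C "h C" \<tau>] C(1) h[OF True]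
            H_space_iff[OF True] by simp
        also have "\<dots> = word_marginal ?E C F \<tau>"
          using step.prems(2)[OF C(1), of \<tau>] C(2) frames_nonempty[of ?E C] finite_frames[of ?E C]
          by (auto simp: h_def less_Suc_eq)
        finally show ?thesis
          by (simp add: word_marginal_diff)
      next
        case False
        \<comment> \<open>Here \<open>C\<close> is a singleton, and its marginal repeats the one on the empty set.\<close>
        have "card C = 1"
          using False C(1) fin by (auto simp: \<P>bar_def \<P>_def not_le less_Suc_eq numeral_2_eq_2)
        have "word_marginal ?E {} F \<rho> = 0" for \<rho>
          using step.prems(2)[of "{}" \<rho>] C(2) \<open>card C = 1\<close> by simp
        then have "sum F (\<Gamma> ?E) = 0"
          by (metis word_marginal_small[of "{}" ?E] empty_subsetI finite.emptyI card.empty zero_le_one)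
        then have "word_marginal ?E C F \<tau> = 0"
          using word_marginal_small[OF C(1) fin] \<open>card C = 1\<close> by (metis order_refl)
        then show ?thesis
          using other False unfolding word_marginal_diff sum by (auto intro!: sum.neutral)
      qed
    qed
    have "F - synthesis ?E H \<in> L_space (\<Gamma> ?E)"
      using step.prems(1) synthesis_in_L_space subspace_diff[OF subspace_L_space] by blast
    then have "F - synthesis ?E H \<in> synthesis ?E ` H_total n"
      using step.IH vanish by blast
    then obtain K where K: "K \<in> H_total n" "F - synthesis ?E H = synthesis ?E K"
      by blast
    then have "F = synthesis ?E (H + K)"
      by (simp add: linear_add[OF linear_synthesis] algebra_simps)
    then show ?case
      using K(1) H subspace_add[OF subspace_H_total] by blast
  qed
  from this[where k = 0] show "F \<in> synthesis ?E ` H_total n" if "F \<in> L_space (\<Gamma> ?E)" for F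
    using that by simp
qed

lemma bij_betw_synthesis:
  "bij_betw (synthesis {1..n}) (H_total n) (L_space (\<Gamma> {1..n}))"
  using inj_on_synthesis L_space_subset_synthesis_image synthesis_in_L_space
  by (auto simp: bij_betw_def)

section \<open>The action of the symmetric group\<close>

lemma map_\<Gamma>_iff:
  assumes "\<sigma> permutes {1..n}"
  shows "map \<sigma> \<pi> \<in> \<Gamma> (\<sigma> ` A) \<longleftrightarrow> \<pi> \<in> \<Gamma> A"
  using permutes_inj[OF assms] by (auto simp: \<Gamma>_def distinct_map inj_image_eq_iff intro: inj_on_subset)

lemma representation_word_action:
  assumes "subspace V" "\<And>\<sigma> F. \<sigma> permutes {1..n} \<Longrightarrow> F \<in> V \<Longrightarrow> word_action \<sigma> F \<in> V"
  shows "representation (sym_group n) V word_action"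
proof -
  have "inv' (\<sigma> \<circ> \<tau>) = inv' \<tau> \<circ> inv' \<sigma>" if "\<sigma> permutes {1..n}" "\<tau> permutes {1..n}" for \<sigma> \<tau>
    using that by (intro o_inv_distrib) (auto intro: permutes_bij)
  then have "word_action (\<sigma> \<circ> \<tau>) F = word_action \<sigma> (word_action \<tau> F)"
    if "\<sigma> permutes {1..n}" "\<tau> permutes {1..n}" for \<sigma> \<tau> F
    using that by (simp add: word_action_def)
  moreover have "word_action id F = F" for F
    by (simp add: word_action_def)
  moreover have "linear (word_action \<sigma>)" for \<sigma>
    by (rule linearI) (auto simp: word_action_def)
  ultimately show ?thesis
    using assms
    by (auto simp: representation_def sym_group_is_group sym_group_carrier sym_group_mult
        sym_group_one)
qed

lemma permutes_image_subset_card: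
  assumes "\<sigma> permutes {1..n}" "B \<subseteq> {1..n}"
  shows "\<sigma> ` B \<subseteq> {1..n}" "card (\<sigma> ` B) = card B"
proof -
  show "\<sigma> ` B \<subseteq> {1..n}"
    using assms(2) permutes_image[OF assms(1)] by blast
  show "card (\<sigma> ` B) = card B"
    using permutes_inj_on[OF assms(1)] by (rule card_image)
qed

lemma permutes_image_\<P>bar:
  assumes "\<sigma> permutes {1..n}" "B \<in> \<P>bar {1..n}"
  shows "\<sigma> ` B \<in> \<P>bar {1..n}"
proof (cases "B = {}")
  case False
  then have "B \<subseteq> {1..n}" "card B \<ge> 2"
    using assms(2) by (auto simp: \<P>bar_def \<P>_def)
  then show ?thesis
    using permutes_image_subset_card[OF assms(1), of B] unfolding \<P>bar_def \<P>_def by simp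
qed (simp add: \<P>bar_def)

lemma word_action_H_space:
  assumes \<sigma>: "\<sigma> permutes {1..n}" and B: "B \<in> \<P>bar {1..n}" and F: "F \<in> H_space n B"
  shows "word_action \<sigma> F \<in> H_space n (\<sigma> ` B)"
proof -
  have img: "\<sigma> ` B \<in> \<P>bar {1..n}"
    by (rule permutes_image_\<P>bar[OF \<sigma> B])
  have inv: "map (inv' \<sigma>) (map \<sigma> \<pi>) = \<pi>" "map \<sigma> (map (inv' \<sigma>) \<pi>) = \<pi>" for \<pi>
    using permutes_inverses[OF \<sigma>] by (simp_all add: map_idI)
  have "word_action \<sigma> F \<in> L_space (\<Gamma> (\<sigma> ` B))"
    using F H_space_iff[OF B] map_\<Gamma>_iff[OF \<sigma>, of "map (inv' \<sigma>) _" B] inv(2)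
    by (auto simp: L_space_def word_action_def)
  moreover have "word_marginal (\<sigma> ` B) C (word_action \<sigma> F) \<tau> = 0" if C: "C \<subset> \<sigma> ` B" for C \<tau>
  proof -
    let ?D = "\<sigma> -` C"
    have D: "?D \<subset> B"
      using C inj_image_mem_iff[OF permutes_inj[OF \<sigma>], of _ B] by blast
    have fil: "filter (\<lambda>x. x \<in> C) (map \<sigma> \<pi>) = map \<sigma> (filter (\<lambda>x. x \<in> ?D) \<pi>)" for \<pi>
      by (simp add: filter_map o_def)
    have "word_marginal (\<sigma> ` B) C (word_action \<sigma> F) \<tau> = word_marginal B ?D F (map (inv' \<sigma>) \<tau>)"
      unfolding word_marginal_def
    proof (rule sum.reindex_bij_witness[of _ "map \<sigma>" "map (inv' \<sigma>)"])
      fix \<pi> assume \<pi>: "\<pi> \<in> {\<pi>. \<pi> \<in> \<Gamma> (\<sigma> ` B) \<and> filter (\<lambda>x. x \<in> C) \<pi> = \<tau>}"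
      then have "map \<sigma> (filter (\<lambda>x. x \<in> ?D) (map (inv' \<sigma>) \<pi>)) = \<tau>"
        using fil[of "map (inv' \<sigma>) \<pi>"] inv(2) by simp
      then show "map (inv' \<sigma>) \<pi> \<in> {\<pi>. \<pi> \<in> \<Gamma> B \<and> filter (\<lambda>x. x \<in> ?D) \<pi> = map (inv' \<sigma>) \<tau>}"
        using \<pi> inv map_\<Gamma>_iff[OF \<sigma>, of "map (inv' \<sigma>) \<pi>" B] by auto
    next
      fix \<pi> assume "\<pi> \<in> {\<pi>. \<pi> \<in> \<Gamma> B \<and> filter (\<lambda>x. x \<in> ?D) \<pi> = map (inv' \<sigma>) \<tau>}"
      then show "map \<sigma> \<pi> \<in> {\<pi>. \<pi> \<in> \<Gamma> (\<sigma> ` B) \<and> filter (\<lambda>x. x \<in> C) \<pi> = \<tau>}"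
        using map_\<Gamma>_iff[OF \<sigma>] inv(2) unfolding mem_Collect_eq fil by auto
    qed (use inv in \<open>auto simp: word_action_def\<close>)
    then show ?thesis
      using F D H_space_iff[OF B] by simp
  qed
  ultimately show ?thesis
    using H_space_iff[OF img] by blast
qed

lemma synthesis_word_action:
  assumes \<tau>: "\<tau> permutes {1..n}"
  shows "synthesis {1..n} (word_action \<tau> F) = word_action \<tau> (synthesis {1..n} F)"
proof
  fix \<sigma>
  have inv: "map (inv' \<tau>) (map \<tau> \<pi>) = \<pi>" "map \<tau> (map (inv' \<tau>) \<pi>) = \<pi>" for \<pi>
    using permutes_inverses[OF \<tau>] by (simp_all add: map_idI)
  have "(\<Sum>(a, \<pi>, b)\<in>windows \<sigma>. F (map (inv' \<tau>) \<pi>)) = (\<Sum>(a, \<pi>, b)\<in>windows (map (inv' \<tau>) \<sigma>). F \<pi>)"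
    by (rule sum.reindex_bij_witness[of _ "\<lambda>(a, \<pi>, b). (map \<tau> a, map \<tau> \<pi>, map \<tau> b)"
          "\<lambda>(a, \<pi>, b). (map (inv' \<tau>) a, map (inv' \<tau>) \<pi>, map (inv' \<tau>) b)"])
      (auto simp: windows_def inv simp flip: map_append simp del: map_map)
  moreover have "map (inv' \<tau>) \<sigma> \<in> \<Gamma> {1..n} \<longleftrightarrow> \<sigma> \<in> \<Gamma> {1..n}"
    using map_\<Gamma>_iff[OF permutes_inv[OF \<tau>], of \<sigma> "{1..n}"] permutes_image[OF permutes_inv[OF \<tau>]]
    by simp
  ultimately show "synthesis {1..n} (word_action \<tau> F) \<sigma> = word_action \<tau> (synthesis {1..n} F) \<sigma>"
    by (simp add: synthesis_def word_action_def)
qed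

text \<open>A permutation \<open>f\<close> corresponds to the word whose \<open>i\<close>-th letter it maps to \<open>i\<close>.\<close>

definition word_of_perm :: "nat \<Rightarrow> (nat \<Rightarrow> nat) \<Rightarrow> nat list"
  where "word_of_perm n f = map (inv' f) [1..<Suc n]"

lemma bij_betw_word_of_perm:
  "bij_betw (word_of_perm n) (carrier (sym_group n)) (\<Gamma> {1..n})"
  unfolding bij_betw_def
proof (intro conjI inj_onI equalityI subsetI)
  fix f g
  assume "f \<in> carrier (sym_group n)" "g \<in> carrier (sym_group n)" "word_of_perm n f = word_of_perm n g"
  then have f: "f permutes {1..n}" and g: "g permutes {1..n}"
    and eq: "\<And>i. i \<in> {1..n} \<Longrightarrow> inv' f i = inv' g i"
    by (auto simp: sym_group_carrier word_of_perm_def simp del: upt_Suc)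
  have "inv' f i = inv' g i" for i
    using eq permutes_not_in[OF permutes_inv[OF f]] permutes_not_in[OF permutes_inv[OF g]]
    by (cases "i \<in> {1..n}") auto
  then have "inv' (inv' f) = inv' (inv' g)"
    by presburger
  then show "f = g"
    using permutes_inv_inv[OF f] permutes_inv_inv[OF g] by simp
next
  fix w assume "w \<in> word_of_perm n ` carrier (sym_group n)"
  then obtain f where f: "f permutes {1..n}" "w = map (inv' f) [1..<Suc n]"
    by (auto simp: sym_group_carrier word_of_perm_def)
  have "set w = {1..n}"
    using permutes_image[OF permutes_inv[OF f(1)]] f(2) by (auto simp: atLeastLessThanSuc_atLeastAtMost simp del: upt_Suc)
  moreover have "distinct w"
    using permutes_inj_on[OF permutes_inv[OF f(1)]] f(2) by (simp add: distinct_map del: upt_Suc)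
  ultimately show "w \<in> \<Gamma> {1..n}"
    by (simp add: \<Gamma>_def)
next
  fix w assume "w \<in> \<Gamma> {1..n}"
  then have w: "distinct w" "set w = {1..n}"
    by (auto simp: \<Gamma>_def)
  then have len: "length w = n"
    using distinct_card by fastforce
  define p where "p i = (if i \<in> {1..n} then w ! (i - 1) else i)" for i
  have "bij_betw (\<lambda>i. i - 1) {1..n} {..<length w}"
    using len by (intro bij_betw_byWitness[of _ Suc]) auto
  from bij_betw_trans[OF this bij_betw_nth[OF w(1) refl w(2)[symmetric]]]
  have "bij_betw (\<lambda>i. w ! (i - 1)) {1..n} {1..n}"
    by (simp add: o_def)
  moreover have "bij_betw p {1..n} {1..n} \<longleftrightarrow> bij_betw (\<lambda>i. w ! (i - 1)) {1..n} {1..n}"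
    by (rule bij_betw_cong) (simp add: p_def)
  ultimately have "bij_betw p {1..n} {1..n}"
    by blast
  then have p: "p permutes {1..n}"
    by (rule bij_imp_permutes) (auto simp: p_def)
  have "word_of_perm n (inv' p) = map p [1..<Suc n]"
    by (simp add: word_of_perm_def permutes_inv_inv[OF p] del: upt_Suc)
  also have "\<dots> = w"
    by (rule nth_equalityI) (auto simp: len p_def simp del: upt_Suc)
  finally have "w = word_of_perm n (inv' p)" ..
  then show "w \<in> word_of_perm n ` carrier (sym_group n)"
    using permutes_inv[OF p] by (auto simp: sym_group_carrier)
qed

lemma word_of_perm_comp:
  assumes "f permutes {1..n}" "\<tau> permutes {1..n}"
  shows "word_of_perm n (f \<circ> \<tau>) = map (inv' \<tau>) (word_of_perm n f)"
  using o_inv_distrib[of f \<tau>] assms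
  by (simp add: word_of_perm_def permutes_bij del: upt_Suc)

lemma bij_betw_L_space:
  assumes "bij_betw h X Y"
  shows "bij_betw (\<lambda>F x. if x \<in> X then F (h x) else 0) (L_space Y) (L_space X)"
  using assms
  by (intro bij_betw_byWitness[where f' = "\<lambda>F y. if y \<in> Y then F (inv_into X h y) else 0"])
    (auto simp: L_space_def fun_eq_iff bij_betw_inv_into_left bij_betw_inv_into_right
      bij_betw_apply bij_betw_apply[OF bij_betw_inv_into])

lemma word_action_subspace_sum:
  assumes \<sigma>: "\<sigma> permutes {1..n}" and I: "I \<subseteq> \<P>bar {1..n}" "\<And>B. B \<in> I \<Longrightarrow> \<sigma> ` B \<in> I"
    and F: "F \<in> subspace_sum I (H_space n)"
  shows "word_action \<sigma> F \<in> subspace_sum I (H_space n)"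
proof -
  have fin: "finite I"
    using I(1) finite_\<P>bar finite_subset by blast
  have sub: "subspace (H_space n B)" if "B \<in> I" for B
    using that I(1) subspace_H_space by blast
  obtain f where f: "\<And>B. B \<in> I \<Longrightarrow> f B \<in> H_space n B" "F = sum f I"
    using F by (rule subspace_sumE) blast
  have "word_action \<sigma> F = (\<Sum>B\<in>I. word_action \<sigma> (f B))"
    by (simp add: f(2) word_action_def sum_fun_apply fun_eq_iff)
  also have "\<dots> \<in> subspace_sum I (H_space n)"
  proof (intro subspace_sum subspace_subspace_sum sub)
    fix B assume B: "B \<in> I"
    have "word_action \<sigma> (f B) \<in> H_space n (\<sigma> ` B)"
      using word_action_H_space[OF \<sigma> _ f(1)[OF B]] B I(1) by blast
    then show "word_action \<sigma> (f B) \<in> subspace_sum I (H_space n)"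
      using summand_subset_subspace_sum[where V = "H_space n", OF fin sub I(2)[OF B]] by blast
  qed
  finally show ?thesis .
qed

lemma representation_subspace_sum_H_space:
  assumes "I \<subseteq> \<P>bar {1..n}" "\<And>\<sigma> B. \<sigma> permutes {1..n} \<Longrightarrow> B \<in> I \<Longrightarrow> \<sigma> ` B \<in> I"
  shows "representation (sym_group n) (subspace_sum I (H_space n)) word_action"
proof (rule representation_word_action)
  show "subspace (subspace_sum I (H_space n))"
    using assms(1) subspace_H_space by (intro subspace_subspace_sum) blast
  show "word_action \<sigma> F \<in> subspace_sum I (H_space n)"
    if "\<sigma> permutes {1..n}" "F \<in> subspace_sum I (H_space n)" for \<sigma> F
    using word_action_subspace_sum[OF that(1) assms(1) _ that(2)] assms(2)[OF that(1)] by blast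
qed

theorem H_total_isomorphic_L_sym:
  "rep_isomorphic (sym_group n) (H_total n) word_action (L_sym n) regular_action"
  unfolding rep_isomorphic_def
proof (intro conjI exI ballI)
  define J where "J F f = (if f \<in> carrier (sym_group n) then F (word_of_perm n f) else 0)"
    for F :: "nat list \<Rightarrow> real" and f
  show "representation (sym_group n) (H_total n) word_action"
    unfolding H_total_def using permutes_image_\<P>bar
    by (intro representation_subspace_sum_H_space subset_refl)
  show "representation (sym_group n) (L_sym n) regular_action"
    by (rule representation_L_sym)
  have "linear J"
    by (rule linearI) (auto simp: J_def)
  then show "linear (J \<circ> synthesis {1..n})"
    by (rule linear_compose[OF linear_synthesis])
  have "bij_betw J (L_space (\<Gamma> {1..n})) (L_sym n)"
    using bij_betw_L_space[OF bij_betw_word_of_perm] unfolding L_sym_def J_def .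
  then show "bij_betw (J \<circ> synthesis {1..n}) (H_total n) (L_sym n)"
    by (rule bij_betw_trans[OF bij_betw_synthesis])
  fix \<tau> F assume "\<tau> \<in> carrier (sym_group n)"
  then have \<tau>: "\<tau> permutes {1..n}"
    by (simp add: sym_group_carrier)
  have "J (word_action \<tau> K) f = regular_action \<tau> (J K) f" for K f
  proof (cases "f permutes {1..n}")
    case True
    then show ?thesis
      using word_of_perm_comp[OF True \<tau>] permutes_compose[OF \<tau> True]
      by (simp add: J_def word_action_def regular_action_def sym_group_carrier)
  next
    case False
    have "f permutes {1..n}" if "(f \<circ> \<tau>) permutes {1..n}"
      using permutes_compose[OF permutes_inv[OF \<tau>] that] permutes_inv_o(1)[OF \<tau>]
      by (simp add: comp_assoc)
    then show ?thesis
      using False by (auto simp: J_def regular_action_def sym_group_carrier)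
  qed
  then show "(J \<circ> synthesis {1..n}) (word_action \<tau> F) =
      regular_action \<tau> ((J \<circ> synthesis {1..n}) F)"
    by (auto simp only: comp_apply synthesis_word_action[OF \<tau>])
qed

section \<open>Tableaux and tabloids\<close>

lemma sum_nat_ge_initial_segment:
  fixes A :: "nat set"
  assumes "finite A"
  shows "\<Sum>{..<card A} \<le> \<Sum>A" and "\<Sum>A \<le> \<Sum>{..<card A} \<Longrightarrow> A = {..<card A}"
proof -
  have "\<Sum>{..<card A} \<le> \<Sum>A \<and> (\<Sum>A \<le> \<Sum>{..<card A} \<longrightarrow> A = {..<card A})"
    using assms
  proof (induction rule: finite_linorder_max_induct)
    case (insert m A)
    then have "A \<subseteq> {..<m}"
      by auto
    then have "card A \<le> m"
      using card_mono[of "{..<m}" A] by simp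
    moreover have "m \<notin> A"
      using insert.hyps by blast
    ultimately show ?case
      using insert by (auto simp: lessThan_Suc)
  qed simp
  then show "\<Sum>{..<card A} \<le> \<Sum>A" and "\<Sum>A \<le> \<Sum>{..<card A} \<Longrightarrow> A = {..<card A}"
    by auto
qed

lemma finite_down_closed_nat:
  fixes A :: "nat set"
  assumes "finite A" "\<And>i j. i \<in> A \<Longrightarrow> j < i \<Longrightarrow> j \<in> A"
  shows "A = {..<card A}"
proof (cases "A = {}")
  case False
  have "j \<in> A" if "j \<le> Max A" for j
    using that assms(2)[OF Max_in[OF assms(1) False], of j] Max_in[OF assms(1) False]
    by (cases "j = Max A") auto
  then have A: "A = {..Max A}"
    using Max_ge[OF assms(1)] by auto
  then have "card A = Suc (Max A)"
    by (metis card_atMost)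
  then show ?thesis
    using A by (simp add: lessThan_Suc_atMost)
qed simp

lemma young_diagram_Sigma: "young_diagram \<mu> = (SIGMA i:{..<length \<mu>}. {..<\<mu> ! i})"
  by (auto simp: young_diagram_def)

lemma finite_young_diagram: "finite (young_diagram \<mu>)"
  by (auto simp: young_diagram_Sigma)

lemma young_diagram_up:
  assumes "integer_partition n \<mu>" "(i, j) \<in> young_diagram \<mu>" "i' < i"
  shows "(i', j) \<in> young_diagram \<mu>"
  using assms sorted_wrt_nth_less[of "(\<ge>)" \<mu> i' i]
  by (auto simp: young_diagram_def integer_partition_def)

lemma tableau_exists:
  assumes "integer_partition n \<mu>"
  obtains t where "tableau n \<mu> t"
proof -
  have "card (young_diagram \<mu>) = n"
    using assms by (simp add: young_diagram_Sigma integer_partition_def sum_list_sum_nth atLeast0LessThan)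
  then show ?thesis
    using finite_same_card_bij[of "young_diagram \<mu>" "{1..n}"] finite_young_diagram that
    by (auto simp: tableau_def)
qed

definition tableau_row :: "nat list \<Rightarrow> (nat \<times> nat \<Rightarrow> nat) \<Rightarrow> nat \<Rightarrow> nat"
  where "tableau_row \<mu> t x = fst (inv_into (young_diagram \<mu>) t x)"

definition tableau_col :: "nat list \<Rightarrow> (nat \<times> nat \<Rightarrow> nat) \<Rightarrow> nat \<Rightarrow> nat"
  where "tableau_col \<mu> t x = snd (inv_into (young_diagram \<mu>) t x)"

lemma tableau_entry:
  assumes "tableau n \<mu> t" "(i, j) \<in> young_diagram \<mu>"
  shows "t (i, j) \<in> {1..n}" "tableau_row \<mu> t (t (i, j)) = i" "tableau_col \<mu> t (t (i, j)) = j"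
  using assms bij_betw_inv_into_left[of t "young_diagram \<mu>" "{1..n}" "(i, j)"]
    bij_betw_apply[of t "young_diagram \<mu>" "{1..n}" "(i, j)"]
  by (auto simp: tableau_def tableau_row_def tableau_col_def)

lemma tableau_position:
  assumes "tableau n \<mu> t" "x \<in> {1..n}"
  shows "(tableau_row \<mu> t x, tableau_col \<mu> t x) \<in> young_diagram \<mu>"
    and "t (tableau_row \<mu> t x, tableau_col \<mu> t x) = x"
  using assms bij_betw_inv_into_right[of t "young_diagram \<mu>" "{1..n}" x]
    bij_betw_apply[OF bij_betw_inv_into, of t "young_diagram \<mu>" "{1..n}" x]
  by (auto simp: tableau_def tableau_row_def tableau_col_def)

lemma tableau_position_inject:
  assumes "tableau n \<mu> t" "x \<in> {1..n}" "y \<in> {1..n}"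
    and "tableau_row \<mu> t x = tableau_row \<mu> t y" "tableau_col \<mu> t x = tableau_col \<mu> t y"
  shows "x = y"
  using tableau_position(2)[OF assms(1,2)] tableau_position(2)[OF assms(1,3)] assms(4,5) by metis

lemma tableau_comp:
  assumes t: "tableau n \<mu> t" and \<sigma>: "\<sigma> permutes {1..n}"
  shows "tableau n \<mu> (\<sigma> \<circ> t)"
    and "x \<in> {1..n} \<Longrightarrow> tableau_row \<mu> (\<sigma> \<circ> t) (\<sigma> x) = tableau_row \<mu> t x"
    and "x \<in> {1..n} \<Longrightarrow> tableau_col \<mu> (\<sigma> \<circ> t) (\<sigma> x) = tableau_col \<mu> t x"
proof -
  show *: "tableau n \<mu> (\<sigma> \<circ> t)"
    using t permutes_imp_bij[OF \<sigma>] bij_betw_trans by (auto simp: tableau_def)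
  assume x: "x \<in> {1..n}"
  have "(\<sigma> \<circ> t) (tableau_row \<mu> t x, tableau_col \<mu> t x) = \<sigma> x"
    using tableau_position(2)[OF t x] by simp
  then show "tableau_row \<mu> (\<sigma> \<circ> t) (\<sigma> x) = tableau_row \<mu> t x"
    "tableau_col \<mu> (\<sigma> \<circ> t) (\<sigma> x) = tableau_col \<mu> t x"
    using tableau_entry(2,3)[OF * tableau_position(1)[OF t x]] by auto
qed

lemma tabloid_comp: "tabloid \<mu> (\<sigma> \<circ> t) = map (image \<sigma>) (tabloid \<mu> t)"
  by (auto simp: tabloid_def)

lemma tabloid_nth:
  assumes "tableau n \<mu> t" "i < length \<mu>"
  shows "tabloid \<mu> t ! i = {x \<in> {1..n}. tableau_row \<mu> t x = i}"
proof -
  have Y: "(i, j) \<in> young_diagram \<mu> \<longleftrightarrow> j < \<mu> ! i" for j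
    using assms(2) by (simp add: young_diagram_def)
  have "{t (i, j) | j. j < \<mu> ! i} = {x \<in> {1..n}. tableau_row \<mu> t x = i}"
  proof (intro equalityI subsetI)
    fix x assume "x \<in> {t (i, j) | j. j < \<mu> ! i}"
    then show "x \<in> {x \<in> {1..n}. tableau_row \<mu> t x = i}"
      using tableau_entry[OF assms(1)] Y by auto
  next
    fix x assume "x \<in> {x \<in> {1..n}. tableau_row \<mu> t x = i}"
    then show "x \<in> {t (i, j) | j. j < \<mu> ! i}"
      using tableau_position[OF assms(1), of x] Y
      by (intro CollectI exI[of _ "tableau_col \<mu> t x"]) auto
  qed
  then show ?thesis
    using assms(2) by (simp add: tabloid_def)
qed

lemma tabloid_eq_iff:
  assumes t: "tableau n \<mu> t" and s: "tableau n \<mu> s"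
  shows "tabloid \<mu> t = tabloid \<mu> s \<longleftrightarrow> (\<forall>x\<in>{1..n}. tableau_row \<mu> t x = tableau_row \<mu> s x)"
proof
  assume eq: "tabloid \<mu> t = tabloid \<mu> s"
  show "\<forall>x\<in>{1..n}. tableau_row \<mu> t x = tableau_row \<mu> s x"
  proof
    fix x assume x: "x \<in> {1..n}"
    have len: "tableau_row \<mu> t x < length \<mu>"
      using tableau_position(1)[OF t x] by (simp add: young_diagram_def)
    have "x \<in> tabloid \<mu> s ! tableau_row \<mu> t x"
      unfolding eq[symmetric] tabloid_nth[OF t len] using x by blast
    then show "tableau_row \<mu> t x = tableau_row \<mu> s x"
      unfolding tabloid_nth[OF s len] by simp
  qed
next
  assume eq: "\<forall>x\<in>{1..n}. tableau_row \<mu> t x = tableau_row \<mu> s x"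
  have len: "length (tabloid \<mu> t) = length \<mu>" "length (tabloid \<mu> s) = length \<mu>"
    by (simp_all add: tabloid_def)
  show "tabloid \<mu> t = tabloid \<mu> s"
    using eq len tabloid_nth[OF t] tabloid_nth[OF s] by (intro nth_equalityI) auto
qed

lemma mem_column_stabilizer:
  assumes t: "tableau n \<mu> t"
  shows "\<sigma> \<in> column_stabilizer n \<mu> t \<longleftrightarrow>
    \<sigma> permutes {1..n} \<and> (\<forall>x\<in>{1..n}. tableau_col \<mu> t (\<sigma> x) = tableau_col \<mu> t x)"
proof
  assume \<sigma>: "\<sigma> \<in> column_stabilizer n \<mu> t"
  show "\<sigma> permutes {1..n} \<and> (\<forall>x\<in>{1..n}. tableau_col \<mu> t (\<sigma> x) = tableau_col \<mu> t x)"
  proof (intro conjI ballI)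
    fix x assume x: "x \<in> {1..n}"
    obtain i' where "(i', tableau_col \<mu> t x) \<in> young_diagram \<mu>" "\<sigma> x = t (i', tableau_col \<mu> t x)"
      using \<sigma> tableau_position[OF t x] unfolding column_stabilizer_def by force
    then show "tableau_col \<mu> t (\<sigma> x) = tableau_col \<mu> t x"
      using tableau_entry[OF t] by simp
  qed (use \<sigma> in \<open>simp add: column_stabilizer_def\<close>)
next
  assume \<sigma>: "\<sigma> permutes {1..n} \<and> (\<forall>x\<in>{1..n}. tableau_col \<mu> t (\<sigma> x) = tableau_col \<mu> t x)"
  have "\<exists>i'. (i', j) \<in> young_diagram \<mu> \<and> \<sigma> (t (i, j)) = t (i', j)" if "(i, j) \<in> young_diagram \<mu>" for i j
  proof -
    note x = tableau_entry[OF t that]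
    have "\<sigma> (t (i, j)) \<in> {1..n}"
      using \<sigma> x(1) permutes_in_image[of \<sigma> "{1..n}" "t (i, j)"] by simp
    from tableau_position[OF t this] show ?thesis
      using \<sigma> x by (intro exI[of _ "tableau_row \<mu> t (\<sigma> (t (i, j)))"]) simp
  qed
  then show "\<sigma> \<in> column_stabilizer n \<mu> t"
    using \<sigma> by (simp add: column_stabilizer_def)
qed

lemma column_stabilizer_permutes: "\<sigma> \<in> column_stabilizer n \<mu> t \<Longrightarrow> \<sigma> permutes {1..n}"
  by (simp add: column_stabilizer_def)

lemma finite_column_stabilizer: "finite (column_stabilizer n \<mu> t)"
  by (rule finite_subset[of _ "{\<sigma>. \<sigma> permutes {1..n}}"])
    (auto simp: column_stabilizer_def finite_permutations)

lemma column_stabilizer_group: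
  assumes t: "tableau n \<mu> t"
  shows "id \<in> column_stabilizer n \<mu> t"
    and "\<sigma> \<in> column_stabilizer n \<mu> t \<Longrightarrow> \<tau> \<in> column_stabilizer n \<mu> t \<Longrightarrow> \<sigma> \<circ> \<tau> \<in> column_stabilizer n \<mu> t"
    and "\<sigma> \<in> column_stabilizer n \<mu> t \<Longrightarrow> inv' \<sigma> \<in> column_stabilizer n \<mu> t"
proof -
  show "id \<in> column_stabilizer n \<mu> t"
    by (simp add: mem_column_stabilizer[OF t] permutes_id)
  show "\<sigma> \<circ> \<tau> \<in> column_stabilizer n \<mu> t"
    if \<sigma>: "\<sigma> \<in> column_stabilizer n \<mu> t" and \<tau>: "\<tau> \<in> column_stabilizer n \<mu> t"
  proof -
    have p: "\<sigma> permutes {1..n}" "\<tau> permutes {1..n}"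
      using \<sigma> \<tau> by (auto dest: column_stabilizer_permutes)
    have "tableau_col \<mu> t (\<sigma> (\<tau> x)) = tableau_col \<mu> t x" if "x \<in> {1..n}" for x
    proof -
      have "\<tau> x \<in> {1..n}"
        using that permutes_in_image[OF p(2)] by blast
      then have "tableau_col \<mu> t (\<sigma> (\<tau> x)) = tableau_col \<mu> t (\<tau> x)"
        using \<sigma> unfolding mem_column_stabilizer[OF t] by blast
      also have "\<dots> = tableau_col \<mu> t x"
        using \<tau> that unfolding mem_column_stabilizer[OF t] by blast
      finally show ?thesis .
    qed
    then show ?thesis
      unfolding mem_column_stabilizer[OF t] using permutes_compose[OF p(2,1)] by simp
  qed
  show "inv' \<sigma> \<in> column_stabilizer n \<mu> t" if \<sigma>: "\<sigma> \<in> column_stabilizer n \<mu> t"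
  proof -
    have p: "\<sigma> permutes {1..n}"
      using \<sigma> by (rule column_stabilizer_permutes)
    have "tableau_col \<mu> t (inv' \<sigma> x) = tableau_col \<mu> t x" if "x \<in> {1..n}" for x
    proof -
      have "inv' \<sigma> x \<in> {1..n}"
        using that permutes_in_image[OF permutes_inv[OF p]] by blast
      then have "tableau_col \<mu> t (\<sigma> (inv' \<sigma> x)) = tableau_col \<mu> t (inv' \<sigma> x)"
        using \<sigma> unfolding mem_column_stabilizer[OF t] by blast
      then show ?thesis
        by (simp add: permutes_inverses(1)[OF p])
    qed
    then show ?thesis
      unfolding mem_column_stabilizer[OF t] using permutes_inv[OF p] by blast
  qed
qed

text \<open>
  Write the entries of a fixed column of \<open>t\<close> by their rows in \<open>s\<close>: these are distinct row indices, so
  their sum is at least that of \<open>0, \<dots>, h - 1\<close>, where \<open>h\<close> is the height of the column. Summed over all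
  columns both sides agree, since the row indices of \<open>s\<close> and of \<open>t\<close> have the same total. So
  equality holds in every column, and the positions (row in \<open>s\<close>, column in \<open>t\<close>) fill the diagram.
\<close>

lemma tabloid_eq_column_permutation:
  assumes \<mu>: "integer_partition n \<mu>" and t: "tableau n \<mu> t" and s: "tableau n \<mu> s"
    and no_pair: "\<And>a b. a \<in> {1..n} \<Longrightarrow> b \<in> {1..n} \<Longrightarrow>
      tableau_row \<mu> s a = tableau_row \<mu> s b \<Longrightarrow> tableau_col \<mu> t a = tableau_col \<mu> t b \<Longrightarrow> a = b"
  obtains \<sigma> where "\<sigma> \<in> column_stabilizer n \<mu> t" "tabloid \<mu> s = tabloid \<mu> (\<sigma> \<circ> t)"
proof -
  let ?Y = "young_diagram \<mu>" and ?rs = "tableau_row \<mu> s" and ?rt = "tableau_row \<mu> t"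
    and ?c = "tableau_col \<mu> t"
  define X where "X j = {x \<in> {1..n}. ?c x = j}" for j
  have fX: "finite (X j)" for j
    by (simp add: X_def)
  have inj_s: "inj_on ?rs (X j)" for j
    using no_pair by (auto simp: X_def inj_on_def)
  have inj_t: "inj_on ?rt (X j)" for j
    using tableau_position_inject[OF t] by (auto simp: X_def inj_on_def)
  have rtX: "?rt ` X j = {i. (i, j) \<in> ?Y}" for j
  proof (intro equalityI subsetI)
    fix i assume "i \<in> {i. (i, j) \<in> ?Y}"
    then show "i \<in> ?rt ` X j"
      using tableau_entry[OF t, of i j] by (intro image_eqI[of _ _ "t (i, j)"]) (auto simp: X_def)
  qed (use tableau_position(1)[OF t] in \<open>auto simp: X_def\<close>)
  have seg_t: "?rt ` X j = {..<card (X j)}" for j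
    using finite_down_closed_nat[of "?rt ` X j"] young_diagram_up[OF \<mu>] card_image[OF inj_t] fX
    unfolding rtX[symmetric] by (metis (mono_tags, lifting) finite_imageI mem_Collect_eq rtX)
  have card_s: "card (?rs ` X j) = card (X j)" for j
    by (rule card_image[OF inj_s])
  have total: "(\<Sum>x\<in>{1..n}. tableau_row \<mu> u x) = (\<Sum>y\<in>?Y. fst y)" if "tableau n \<mu> u" for u
  proof -
    have "(\<Sum>x\<in>{1..n}. tableau_row \<mu> u x) = (\<Sum>y\<in>?Y. tableau_row \<mu> u (u y))"
      using that by (intro sum.reindex_bij_betw[symmetric]) (simp add: tableau_def)
    then show ?thesis
      using tableau_entry(2)[OF that] by (auto intro: sum.cong)
  qed
  have cols: "(\<Sum>x\<in>{1..n}. f x) = (\<Sum>j\<in>?c ` {1..n}. \<Sum>x\<in>X j. f x)" for f :: "nat \<Rightarrow> nat"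
    unfolding X_def by (rule sum.group[symmetric]) auto
  have "(\<Sum>j\<in>?c ` {1..n}. \<Sum>(?rs ` X j)) = (\<Sum>j\<in>?c ` {1..n}. \<Sum>{..<card (X j)})"
    using total[OF s] total[OF t] cols[of ?rs] cols[of ?rt]
    by (simp add: sum.reindex[OF inj_s] sum.reindex[OF inj_t] flip: seg_t)
  moreover have ge: "\<Sum>{..<card (X j)} \<le> \<Sum>(?rs ` X j)" for j
    using sum_nat_ge_initial_segment(1)[of "?rs ` X j"] fX card_s by simp
  ultimately have eq: "\<Sum>{..<card (X j)} = \<Sum>(?rs ` X j)" if "j \<in> ?c ` {1..n}" for j
    using sum_mono_inv[of "\<lambda>j. \<Sum>{..<card (X j)}" "?c ` {1..n}" "\<lambda>j. \<Sum>(?rs ` X j)" j] that by simp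
  have rs_rt: "?rs ` X j = ?rt ` X j" for j
  proof (cases "j \<in> ?c ` {1..n}")
    case True
    then show ?thesis
      using sum_nat_ge_initial_segment(2)[of "?rs ` X j"] eq[OF True] fX card_s seg_t by simp
  next
    case False
    then have "X j = {}"
      by (auto simp: X_def)
    then show ?thesis by simp
  qed
  define pos where "pos x = (?rs x, ?c x)" for x
  have "bij_betw pos {1..n} ?Y"
    unfolding bij_betw_def
  proof (intro conjI equalityI subsetI)
    show "inj_on pos {1..n}"
      using no_pair by (auto simp: pos_def inj_on_def)
    fix y assume "y \<in> pos ` {1..n}"
    then obtain x where x: "x \<in> {1..n}" "y = (?rs x, ?c x)"
      by (auto simp: pos_def)
    then have "?rs x \<in> ?rs ` X (?c x)"
      by (simp add: X_def)
    then show "y \<in> ?Y"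
      using rs_rt rtX x(2) by blast
  next
    fix y assume y: "y \<in> ?Y"
    then have "fst y \<in> ?rs ` X (snd y)"
      using rs_rt rtX by auto
    then show "y \<in> pos ` {1..n}"
      by (auto simp: X_def pos_def image_iff prod_eq_iff)
  qed
  then have bij: "bij_betw (inv_into {1..n} pos) ?Y {1..n}"
    by (rule bij_betw_inv_into)
  have pos_inv: "pos (inv_into {1..n} pos y) = y" if "y \<in> ?Y" for y
    using that \<open>bij_betw pos {1..n} ?Y\<close> by (simp add: bij_betw_inv_into_right)
  define \<sigma> where "\<sigma> x = (if x \<in> {1..n} then inv_into {1..n} pos (?rt x, ?c x) else x)" for x
  have \<sigma>_pos: "pos (\<sigma> x) = (?rt x, ?c x)" "\<sigma> x \<in> {1..n}" if "x \<in> {1..n}" for x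
    using that pos_inv[OF tableau_position(1)[OF t that]]
      bij_betw_apply[OF bij tableau_position(1)[OF t that]] by (simp_all add: \<sigma>_def)
  have "inj_on \<sigma> {1..n}"
  proof (rule inj_onI)
    fix x y assume xy: "x \<in> {1..n}" "y \<in> {1..n}" "\<sigma> x = \<sigma> y"
    then have "(?rt x, ?c x) = (?rt y, ?c y)"
      using \<sigma>_pos by metis
    then show "x = y"
      using tableau_position_inject[OF t xy(1,2)] by simp
  qed
  moreover have "\<sigma> ` {1..n} \<subseteq> {1..n}"
    using \<sigma>_pos(2) by blast
  ultimately have "bij_betw \<sigma> {1..n} {1..n}"
    by (simp add: bij_betw_def endo_inj_surj)
  then have \<sigma>: "\<sigma> permutes {1..n}"
    by (rule bij_imp_permutes) (auto simp: \<sigma>_def)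
  have "\<sigma> \<in> column_stabilizer n \<mu> t"
    using \<sigma> \<sigma>_pos(1) by (auto simp: mem_column_stabilizer[OF t] pos_def)
  moreover have "tabloid \<mu> s = tabloid \<mu> (\<sigma> \<circ> t)"
    unfolding tabloid_eq_iff[OF s tableau_comp(1)[OF t \<sigma>]]
  proof
    fix y assume y: "y \<in> {1..n}"
    then obtain x where x: "x \<in> {1..n}" "y = \<sigma> x"
      using permutes_image[OF \<sigma>] by blast
    then show "?rs y = tableau_row \<mu> (\<sigma> \<circ> t) y"
      using \<sigma>_pos(1)[OF x(1)] tableau_comp(2)[OF t \<sigma> x(1)] by (simp add: pos_def)
  qed
  ultimately show ?thesis
    by (rule that)
qed

definition tabloids :: "nat \<Rightarrow> nat list \<Rightarrow> nat set list set"
  where "tabloids n \<mu> = {tabloid \<mu> t | t. tableau n \<mu> t}"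

lemma finite_tabloids: "finite (tabloids n \<mu>)"
proof (rule finite_subset)
  show "tabloids n \<mu> \<subseteq> {R. set R \<subseteq> Pow {1..n} \<and> length R = length \<mu>}"
  proof
    fix R assume "R \<in> tabloids n \<mu>"
    then obtain t where t: "tableau n \<mu> t" "R = tabloid \<mu> t"
      by (auto simp: tabloids_def)
    have "length R = length \<mu>"
      by (simp add: t(2) tabloid_def)
    moreover have "set R \<subseteq> Pow {1..n}"
      using calculation tabloid_nth[OF t(1)] t(2) by (auto simp: in_set_conv_nth)
    ultimately show "R \<in> {R. set R \<subseteq> Pow {1..n} \<and> length R = length \<mu>}"
      by simp
  qed
qed (simp add: finite_lists_length_eq)

section \<open>Specht modules\<close>

lemma sign_comp_permutes:
  assumes "\<sigma> permutes {1..n::nat}" "\<tau> permutes {1..n}"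
  shows "sign (\<sigma> \<circ> \<tau>) = sign \<sigma> * sign \<tau>"
  using assms by (intro sign_compose) (auto simp: permutation_permutes)

lemma sign_mult_self: "(of_int (sign \<sigma>) :: real) * of_int (sign \<sigma>) = 1"
  by (simp add: sign_def)

lemma L_space_eq_sum_dirac:
  assumes "finite E" "F \<in> L_space E"
  shows "F = (\<Sum>x\<in>E. F x *\<^sub>R dirac x)"
proof
  fix y
  have "(\<Sum>x\<in>E. F x *\<^sub>R dirac x) y = (\<Sum>x\<in>E. if y = x then F x else 0)"
    by (auto simp: sum_fun_apply dirac_def indicator_def intro!: sum.cong)
  then show "F y = (\<Sum>x\<in>E. F x *\<^sub>R dirac x) y"
    using assms by (auto simp: L_space_def)
qed

lemma L_space_subset_span_dirac:
  assumes "finite E"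
  shows "L_space E \<subseteq> span (dirac ` E)"
proof
  fix F assume "F \<in> L_space E"
  then have F: "F = (\<Sum>x\<in>E. F x *\<^sub>R dirac x)"
    by (rule L_space_eq_sum_dirac[OF assms])
  show "F \<in> span (dirac ` E)"
    by (subst F) (auto intro!: span_sum span_scale intro: span_base)
qed

lemma linear_tabloid_action: "linear (tabloid_action \<sigma>)"
  by (rule linearI) (auto simp: tabloid_action_def)

definition column_antisymmetrizer ::
    "nat \<Rightarrow> nat list \<Rightarrow> (nat \<times> nat \<Rightarrow> nat) \<Rightarrow> (nat set list \<Rightarrow> real) \<Rightarrow> nat set list \<Rightarrow> real"
  where "column_antisymmetrizer n \<mu> t F =
    (\<Sum>\<sigma>\<in>column_stabilizer n \<mu> t. of_int (sign \<sigma>) *\<^sub>R tabloid_action \<sigma> F)"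

lemma linear_column_antisymmetrizer: "linear (column_antisymmetrizer n \<mu> t)"
  unfolding column_antisymmetrizer_def
  by (intro linear_compose_sum ballI linear_compose_scale_right linear_tabloid_action)

lemma column_antisymmetrizer_dirac:
  "column_antisymmetrizer n \<mu> t (dirac (tabloid \<mu> s)) =
    (\<Sum>\<sigma>\<in>column_stabilizer n \<mu> t. of_int (sign \<sigma>) *\<^sub>R dirac (tabloid \<mu> (\<sigma> \<circ> s)))"
  unfolding column_antisymmetrizer_def
  using tabloid_action_dirac[OF column_stabilizer_permutes] by (intro sum.cong) auto

lemma polytabloid_eq_antisymmetrizer:
  "polytabloid n \<mu> t = column_antisymmetrizer n \<mu> t (dirac (tabloid \<mu> t))"
  by (simp add: column_antisymmetrizer_dirac polytabloid_def)

text \<open>The antisymmetrizer absorbs a column permutation at the cost of its sign.\<close>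

lemma column_antisymmetrizer_permuted:
  assumes t: "tableau n \<mu> t" and \<tau>: "\<tau> \<in> column_stabilizer n \<mu> t"
  shows "column_antisymmetrizer n \<mu> t (dirac (tabloid \<mu> (\<tau> \<circ> s))) =
    of_int (sign \<tau>) *\<^sub>R column_antisymmetrizer n \<mu> t (dirac (tabloid \<mu> s))"
proof -
  note C = column_stabilizer_group[OF t]
  have inv: "inv' \<tau> \<circ> \<tau> = id" "\<tau> \<circ> inv' \<tau> = id"
    using permutes_inv_o[OF column_stabilizer_permutes[OF \<tau>]] by auto
  have "(\<Sum>\<sigma>\<in>column_stabilizer n \<mu> t. of_int (sign \<sigma>) *\<^sub>R dirac (tabloid \<mu> (\<sigma> \<circ> (\<tau> \<circ> s)))) =
      (\<Sum>\<sigma>\<in>column_stabilizer n \<mu> t.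
        (of_int (sign \<tau>) * of_int (sign \<sigma>)) *\<^sub>R dirac (tabloid \<mu> (\<sigma> \<circ> s)))"
  proof (rule sum.reindex_bij_witness[of _ "\<lambda>\<sigma>. \<sigma> \<circ> inv' \<tau>" "\<lambda>\<sigma>. \<sigma> \<circ> \<tau>"])
    fix \<sigma> assume \<sigma>: "\<sigma> \<in> column_stabilizer n \<mu> t"
    have sgn: "of_int (sign \<tau>) * of_int (sign (\<sigma> \<circ> \<tau>)) = (of_int (sign \<sigma>) :: real)"
      using sign_comp_permutes[OF \<sigma>[THEN column_stabilizer_permutes] \<tau>[THEN column_stabilizer_permutes]]
        sign_mult_self[of \<tau>] by (simp add: algebra_simps)
    show "(of_int (sign \<tau>) * of_int (sign (\<sigma> \<circ> \<tau>))) *\<^sub>R dirac (tabloid \<mu> (\<sigma> \<circ> \<tau> \<circ> s)) =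
        of_int (sign \<sigma>) *\<^sub>R dirac (tabloid \<mu> (\<sigma> \<circ> (\<tau> \<circ> s)))"
      unfolding sgn by (simp add: comp_assoc)
  qed (use C \<tau> inv in \<open>auto simp: comp_assoc\<close>)
  then show ?thesis
    by (simp add: column_antisymmetrizer_dirac scaleR_sum_right)
qed

text \<open>
  If two entries lie in the same row of \<open>s\<close> and in the same column of \<open>t\<close>, then their transposition
  fixes the tabloid of \<open>s\<close> and negates the antisymmetrizer, which therefore gives 0. Otherwise the
  tabloid of \<open>s\<close> is that of \<open>t\<close> up to a column permutation.
\<close>

lemma column_antisymmetrizer_tabloid:
  assumes \<mu>: "integer_partition n \<mu>" and t: "tableau n \<mu> t" and s: "tableau n \<mu> s"
  shows "column_antisymmetrizer n \<mu> t (dirac (tabloid \<mu> s)) \<in> span {polytabloid n \<mu> t}"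
proof (cases "\<exists>a b. a \<in> {1..n} \<and> b \<in> {1..n} \<and> a \<noteq> b \<and> tableau_row \<mu> s a = tableau_row \<mu> s b \<and>
    tableau_col \<mu> t a = tableau_col \<mu> t b")
  case True
  then obtain a b where ab: "a \<in> {1..n}" "b \<in> {1..n}" "a \<noteq> b"
      "tableau_row \<mu> s a = tableau_row \<mu> s b" "tableau_col \<mu> t a = tableau_col \<mu> t b"
    by blast
  let ?\<tau> = "Transposition.transpose a b"
  have \<tau>: "?\<tau> permutes {1..n}"
    using ab by (intro permutes_swap_id)
  have "?\<tau> \<in> column_stabilizer n \<mu> t"
    using \<tau> ab by (auto simp: mem_column_stabilizer[OF t] Transposition.transpose_def)
  moreover have "tabloid \<mu> (?\<tau> \<circ> s) = tabloid \<mu> s"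
    unfolding tabloid_eq_iff[OF tableau_comp(1)[OF s \<tau>] s]
  proof
    fix x assume x: "x \<in> {1..n}"
    then have "?\<tau> x \<in> {1..n}"
      using permutes_in_image[OF \<tau>] by blast
    then have "tableau_row \<mu> (?\<tau> \<circ> s) x = tableau_row \<mu> s (?\<tau> x)"
      using tableau_comp(2)[OF s \<tau>, of "?\<tau> x"] by simp
    then show "tableau_row \<mu> (?\<tau> \<circ> s) x = tableau_row \<mu> s x"
      using ab by (auto simp: Transposition.transpose_def)
  qed
  ultimately have "column_antisymmetrizer n \<mu> t (dirac (tabloid \<mu> s)) =
      - column_antisymmetrizer n \<mu> t (dirac (tabloid \<mu> s))"
    using column_antisymmetrizer_permuted[OF t, of ?\<tau> s] ab(3) by (simp add: sign_swap_id)
  then have "column_antisymmetrizer n \<mu> t (dirac (tabloid \<mu> s)) = 0"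
    by (simp add: fun_eq_iff)
  then show ?thesis
    by (simp add: span_zero)
next
  case False
  then obtain \<sigma> where "\<sigma> \<in> column_stabilizer n \<mu> t" "tabloid \<mu> s = tabloid \<mu> (\<sigma> \<circ> t)"
    using tabloid_eq_column_permutation[OF \<mu> t s] by metis
  then show ?thesis
    using column_antisymmetrizer_permuted[OF t]
    by (auto simp: polytabloid_eq_antisymmetrizer intro: span_scale span_base)
qed

lemma column_antisymmetrizer_in_span:
  assumes \<mu>: "integer_partition n \<mu>" and t: "tableau n \<mu> t" and F: "F \<in> L_space (tabloids n \<mu>)"
  shows "column_antisymmetrizer n \<mu> t F \<in> span {polytabloid n \<mu> t}"
proof -
  have "column_antisymmetrizer n \<mu> t F =
      (\<Sum>R\<in>tabloids n \<mu>. F R *\<^sub>R column_antisymmetrizer n \<mu> t (dirac R))"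
    by (subst L_space_eq_sum_dirac[OF finite_tabloids F])
      (simp add: linear_sum[OF linear_column_antisymmetrizer]
        linear_scale[OF linear_column_antisymmetrizer])
  then show ?thesis
    using column_antisymmetrizer_tabloid[OF \<mu> t]
    by (auto simp: tabloids_def intro!: span_sum span_scale)
qed

text \<open>Conjugation by \<open>\<sigma>\<close> carries the column stabilizer of \<open>t\<close> to that of \<open>\<sigma> \<circ> t\<close> and preserves signs.\<close>

lemma tabloid_action_polytabloid:
  assumes t: "tableau n \<mu> t" and \<sigma>: "\<sigma> permutes {1..n}"
  shows "tabloid_action \<sigma> (polytabloid n \<mu> t) = polytabloid n \<mu> (\<sigma> \<circ> t)"
proof -
  note \<sigma>' = permutes_inv[OF \<sigma>]
  have inv: "\<sigma> \<circ> inv' \<sigma> = id" "inv' \<sigma> \<circ> \<sigma> = id"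
    using permutes_inv_o[OF \<sigma>] by auto
  have inv': "\<sigma> (inv' \<sigma> x) = x" "inv' \<sigma> (\<sigma> x) = x" for x
    using permutes_inverses[OF \<sigma>] by auto
  note t' = tableau_comp[OF t \<sigma>]
  have col: "tableau_col \<mu> (\<sigma> \<circ> t) x = tableau_col \<mu> t (inv' \<sigma> x)" if "x \<in> {1..n}" for x
    using t'(3)[of "inv' \<sigma> x"] that permutes_in_image[OF \<sigma>'] inv' by simp
  have sgn: "sign (\<sigma> \<circ> \<rho> \<circ> inv' \<sigma>) = sign \<rho>" if "\<rho> permutes {1..n}" for \<rho>
  proof -
    have "sign (\<sigma> \<circ> \<rho> \<circ> inv' \<sigma>) = sign \<sigma> * sign \<rho> * sign (inv' \<sigma>)"
      using sign_comp_permutes[OF permutes_compose[OF that \<sigma>] \<sigma>'] sign_comp_permutes[OF \<sigma> that]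
      by simp
    also have "sign (inv' \<sigma>) = sign \<sigma>"
      using \<sigma> by (intro sign_inverse) (auto simp: permutation_permutes)
    also have "sign \<sigma> * sign \<rho> * sign \<sigma> = sign \<rho> * (sign \<sigma> * sign \<sigma>)"
      by (simp only: mult_ac)
    finally show ?thesis
      by (simp only: sign_idempotent mult_1_right)
  qed
  have conj: "\<sigma> \<circ> \<rho> \<circ> inv' \<sigma> \<in> column_stabilizer n \<mu> (\<sigma> \<circ> t)" if "\<rho> \<in> column_stabilizer n \<mu> t" for \<rho>
  proof -
    have \<rho>: "\<rho> permutes {1..n}"
      using that by (rule column_stabilizer_permutes)
    have "\<sigma> \<circ> \<rho> \<circ> inv' \<sigma> permutes {1..n}"
      by (intro permutes_compose \<sigma> \<sigma>' \<rho>)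
    moreover have "tableau_col \<mu> (\<sigma> \<circ> t) (\<sigma> (\<rho> (inv' \<sigma> x))) = tableau_col \<mu> (\<sigma> \<circ> t) x"
      if x: "x \<in> {1..n}" for x
      using \<open>\<rho> \<in> column_stabilizer n \<mu> t\<close> col[OF x] t'(3) x
        permutes_in_image[OF \<sigma>'] permutes_in_image[OF \<rho>] by (simp add: mem_column_stabilizer[OF t])
    ultimately show ?thesis
      unfolding mem_column_stabilizer[OF t'(1)] by simp
  qed
  have conj': "inv' \<sigma> \<circ> \<rho> \<circ> \<sigma> \<in> column_stabilizer n \<mu> t" if "\<rho> \<in> column_stabilizer n \<mu> (\<sigma> \<circ> t)" for \<rho>
  proof -
    have \<rho>: "\<rho> permutes {1..n}"
      using that by (rule column_stabilizer_permutes)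
    have "inv' \<sigma> \<circ> \<rho> \<circ> \<sigma> permutes {1..n}"
      by (intro permutes_compose \<sigma> \<sigma>' \<rho>)
    moreover have "tableau_col \<mu> t (inv' \<sigma> (\<rho> (\<sigma> x))) = tableau_col \<mu> t x" if x: "x \<in> {1..n}" for x
    proof -
      have "\<sigma> x \<in> {1..n}" "\<rho> (\<sigma> x) \<in> {1..n}"
        using x permutes_in_image[OF \<sigma>] permutes_in_image[OF \<rho>] by blast+
      then show ?thesis
        using \<open>\<rho> \<in> column_stabilizer n \<mu> (\<sigma> \<circ> t)\<close> col[of "\<rho> (\<sigma> x)"] t'(3)[OF x]
        unfolding mem_column_stabilizer[OF t'(1)] by simp
    qed
    ultimately show ?thesis
      unfolding mem_column_stabilizer[OF t] by simp
  qed
  have "tabloid_action \<sigma> (polytabloid n \<mu> t) =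
      (\<Sum>\<rho>\<in>column_stabilizer n \<mu> t. of_int (sign \<rho>) *\<^sub>R dirac (tabloid \<mu> (\<sigma> \<circ> (\<rho> \<circ> t))))"
    by (simp add: polytabloid_def linear_sum[OF linear_tabloid_action]
        linear_scale[OF linear_tabloid_action] tabloid_action_dirac[OF \<sigma>])
  also have "\<dots> = polytabloid n \<mu> (\<sigma> \<circ> t)"
    unfolding polytabloid_def
  proof (rule sum.reindex_bij_witness[of _ "\<lambda>\<rho>. inv' \<sigma> \<circ> \<rho> \<circ> \<sigma>" "\<lambda>\<rho>. \<sigma> \<circ> \<rho> \<circ> inv' \<sigma>"])
    fix \<rho> assume \<rho>: "\<rho> \<in> column_stabilizer n \<mu> t"
    have "\<sigma> \<circ> \<rho> \<circ> inv' \<sigma> \<circ> (\<sigma> \<circ> t) = \<sigma> \<circ> (\<rho> \<circ> t)"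
      by (simp add: fun_eq_iff inv')
    then show "of_int (sign (\<sigma> \<circ> \<rho> \<circ> inv' \<sigma>)) *\<^sub>R dirac (tabloid \<mu> (\<sigma> \<circ> \<rho> \<circ> inv' \<sigma> \<circ> (\<sigma> \<circ> t))) =
        of_int (sign \<rho>) *\<^sub>R dirac (tabloid \<mu> (\<sigma> \<circ> (\<rho> \<circ> t)))"
      using sgn[OF column_stabilizer_permutes[OF \<rho>]] by metis
  qed (use conj conj' in \<open>auto simp: fun_eq_iff inv'\<close>)
  finally show ?thesis .
qed

lemma polytabloid_column_permutation:
  assumes t: "tableau n \<mu> t" and \<sigma>: "\<sigma> \<in> column_stabilizer n \<mu> t"
  shows "polytabloid n \<mu> (\<sigma> \<circ> t) = of_int (sign \<sigma>) *\<^sub>R polytabloid n \<mu> t"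
proof -
  have p: "\<sigma> permutes {1..n}"
    using \<sigma> by (rule column_stabilizer_permutes)
  note t' = tableau_comp[OF t p]
  have col: "tableau_col \<mu> (\<sigma> \<circ> t) x = tableau_col \<mu> t x" if "x \<in> {1..n}" for x
  proof -
    have "inv' \<sigma> x \<in> {1..n}" "\<sigma> (inv' \<sigma> x) = x"
      using that permutes_in_image[OF permutes_inv[OF p]] permutes_inverses(1)[OF p] by auto
    then show ?thesis
      using t'(3)[of "inv' \<sigma> x"] \<sigma> unfolding mem_column_stabilizer[OF t] by metis
  qed
  have "\<rho> \<in> column_stabilizer n \<mu> (\<sigma> \<circ> t) \<longleftrightarrow> \<rho> \<in> column_stabilizer n \<mu> t" for \<rho>
    unfolding mem_column_stabilizer[OF t] mem_column_stabilizer[OF t'(1)]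
    using col permutes_in_image[of \<rho> "{1..n}"] by (metis (no_types, lifting))
  then have "column_stabilizer n \<mu> (\<sigma> \<circ> t) = column_stabilizer n \<mu> t"
    by blast
  then have "polytabloid n \<mu> (\<sigma> \<circ> t) = column_antisymmetrizer n \<mu> t (dirac (tabloid \<mu> (\<sigma> \<circ> t)))"
    by (simp add: polytabloid_def column_antisymmetrizer_dirac)
  then show ?thesis
    using column_antisymmetrizer_permuted[OF t \<sigma>] by (simp add: polytabloid_eq_antisymmetrizer)
qed

lemma column_antisymmetrizer_polytabloid:
  assumes t: "tableau n \<mu> t"
  shows "column_antisymmetrizer n \<mu> t (polytabloid n \<mu> t) =
    real (card (column_stabilizer n \<mu> t)) *\<^sub>R polytabloid n \<mu> t"
proof -
  have "column_antisymmetrizer n \<mu> t (polytabloid n \<mu> t) =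
      (\<Sum>\<sigma>\<in>column_stabilizer n \<mu> t. polytabloid n \<mu> t)"
    unfolding column_antisymmetrizer_def
  proof (rule sum.cong)
    fix \<sigma> assume \<sigma>: "\<sigma> \<in> column_stabilizer n \<mu> t"
    show "of_int (sign \<sigma>) *\<^sub>R tabloid_action \<sigma> (polytabloid n \<mu> t) = polytabloid n \<mu> t"
      using tabloid_action_polytabloid[OF t column_stabilizer_permutes[OF \<sigma>]]
        polytabloid_column_permutation[OF t \<sigma>] sign_mult_self[of \<sigma>] by simp
  qed simp
  then show ?thesis
    by (simp add: sum_constant_scaleR del: sum_constant)
qed

lemma polytabloid_in_L_space:
  assumes t: "tableau n \<mu> t"
  shows "polytabloid n \<mu> t \<in> L_space (tabloids n \<mu>)"
  unfolding polytabloid_def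
proof (intro subspace_sum subspace_scale subspace_L_space)
  fix \<sigma> assume "\<sigma> \<in> column_stabilizer n \<mu> t"
  then have "tabloid \<mu> (\<sigma> \<circ> t) \<in> tabloids n \<mu>"
    using tableau_comp(1)[OF t column_stabilizer_permutes] by (auto simp: tabloids_def)
  then show "dirac (tabloid \<mu> (\<sigma> \<circ> t)) \<in> L_space (tabloids n \<mu>)"
    by (auto simp: L_space_def dirac_def indicator_def)
qed

text \<open>
  Only the identity preserves both the rows and the columns of \<open>t\<close>, so the tabloid of \<open>t\<close> occurs just
  once in its polytabloid.
\<close>

lemma polytabloid_nonzero:
  assumes t: "tableau n \<mu> t"
  shows "polytabloid n \<mu> t \<noteq> 0"
proof -
  have "\<sigma> = id" if \<sigma>: "\<sigma> \<in> column_stabilizer n \<mu> t" "tabloid \<mu> (\<sigma> \<circ> t) = tabloid \<mu> t" for \<sigma>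
  proof
    fix x
    have p: "\<sigma> permutes {1..n}"
      using \<sigma>(1) by (rule column_stabilizer_permutes)
    show "\<sigma> x = id x"
    proof (cases "x \<in> {1..n}")
      case True
      have "\<sigma> x \<in> {1..n}"
        using True permutes_in_image[OF p] by blast
      moreover have "tableau_row \<mu> t (\<sigma> x) = tableau_row \<mu> t x"
        using \<sigma>(2) calculation tableau_comp(2)[OF t p True]
        unfolding tabloid_eq_iff[OF tableau_comp(1)[OF t p] t] by metis
      moreover have "tableau_col \<mu> t (\<sigma> x) = tableau_col \<mu> t x"
        using \<sigma>(1) True unfolding mem_column_stabilizer[OF t] by blast
      ultimately show ?thesis
        using tableau_position_inject[OF t _ True] by simp
    next
      case False
      then show ?thesis
        using permutes_not_in[OF p] by simp
    qed
  qed
  then have "polytabloid n \<mu> t (tabloid \<mu> t) =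
      (\<Sum>\<sigma>\<in>column_stabilizer n \<mu> t. if \<sigma> = id then 1 else 0)"
    unfolding polytabloid_def sum_fun_apply
    by (intro sum.cong) (auto simp: dirac_def indicator_def sign_id)
  also have "\<dots> = 1"
    using finite_column_stabilizer column_stabilizer_group(1)[OF t] by simp
  finally show ?thesis by auto
qed

lemma specht_subset_L_space: "specht n \<mu> \<subseteq> L_space (tabloids n \<mu>)"
  unfolding specht_def using polytabloid_in_L_space
  by (intro span_minimal subspace_L_space) auto

lemma polytabloid_in_specht: "tableau n \<mu> t \<Longrightarrow> polytabloid n \<mu> t \<in> specht n \<mu>"
  unfolding specht_def by (auto intro: span_base)

lemma representation_specht: "representation (sym_group n) (specht n \<mu>) tabloid_action"
proof -
  have "tabloid_action \<sigma> ` specht n \<mu> \<subseteq> specht n \<mu>" if \<sigma>: "\<sigma> permutes {1..n}" for \<sigma>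
  proof -
    have "tabloid_action \<sigma> ` specht n \<mu> = span (tabloid_action \<sigma> ` {polytabloid n \<mu> t | t. tableau n \<mu> t})"
      unfolding specht_def by (rule linear_span_image[OF linear_tabloid_action, symmetric])
    also have "\<dots> \<subseteq> specht n \<mu>"
      using tabloid_action_polytabloid[OF _ \<sigma>] tableau_comp(1)[OF _ \<sigma>]
      unfolding specht_def by (intro span_mono) auto
    finally show ?thesis .
  qed
  moreover have "tabloid_action (\<sigma> \<circ> \<tau>) F = tabloid_action \<sigma> (tabloid_action \<tau> F)"
    if "\<sigma> permutes {1..n}" "\<tau> permutes {1..n}" for \<sigma> \<tau> F
  proof -
    have "inv' (\<sigma> \<circ> \<tau>) = inv' \<tau> \<circ> inv' \<sigma>"
      using that by (intro o_inv_distrib) (auto intro: permutes_bij)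
    then show ?thesis
      by (simp add: tabloid_action_def image_comp o_def)
  qed
  moreover have "tabloid_action id F = F" for F
    by (simp add: tabloid_action_def)
  ultimately show ?thesis
    by (auto simp: representation_def sym_group_is_group sym_group_carrier sym_group_mult
        sym_group_one linear_tabloid_action specht_def)
qed

lemma polytabloid_cong:
  assumes "\<And>y. y \<in> young_diagram \<mu> \<Longrightarrow> t y = s y"
  shows "polytabloid n \<mu> t = polytabloid n \<mu> s"
proof -
  have "tabloid \<mu> (\<sigma> \<circ> t) = tabloid \<mu> (\<sigma> \<circ> s)" for \<sigma>
    using assms by (force simp: tabloid_def young_diagram_def)
  moreover have "column_stabilizer n \<mu> t = column_stabilizer n \<mu> s"
    using assms unfolding column_stabilizer_def by (metis (no_types, lifting))
  ultimately show ?thesis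
    by (simp add: polytabloid_def)
qed

lemma polytabloid_orbit:
  assumes t: "tableau n \<mu> t" and s: "tableau n \<mu> s"
  obtains \<sigma> where "\<sigma> permutes {1..n}" "polytabloid n \<mu> s = tabloid_action \<sigma> (polytabloid n \<mu> t)"
proof -
  let ?Y = "young_diagram \<mu>"
  define \<sigma> where "\<sigma> x = (if x \<in> {1..n} then s (inv_into ?Y t x) else x)" for x
  have "bij_betw (s \<circ> inv_into ?Y t) {1..n} {1..n}"
    using t s bij_betw_trans[OF bij_betw_inv_into] by (auto simp: tableau_def)
  moreover have "bij_betw \<sigma> {1..n} {1..n} \<longleftrightarrow> bij_betw (s \<circ> inv_into ?Y t) {1..n} {1..n}"
    by (rule bij_betw_cong) (simp add: \<sigma>_def)
  ultimately have "bij_betw \<sigma> {1..n} {1..n}"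
    by blast
  then have \<sigma>: "\<sigma> permutes {1..n}"
    by (rule bij_imp_permutes) (auto simp: \<sigma>_def)
  have "polytabloid n \<mu> s = polytabloid n \<mu> (\<sigma> \<circ> t)"
    using t bij_betw_apply[of t ?Y "{1..n}"] bij_betw_inv_into_left[of t ?Y "{1..n}"]
    by (intro polytabloid_cong) (auto simp: \<sigma>_def tableau_def)
  then show ?thesis
    using that[OF \<sigma>] tabloid_action_polytabloid[OF t \<sigma>] by simp
qed

text \<open>
  The antisymmetrizer is self-adjoint for the inner product in which the tabloids are orthonormal, so
  its coefficient at the tabloid of \<open>t\<close> is the inner product with the polytabloid.
\<close>

lemma column_antisymmetrizer_coefficient:
  assumes t: "tableau n \<mu> t"
  shows "column_antisymmetrizer n \<mu> t F (tabloid \<mu> t) =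
    (\<Sum>R\<in>tabloids n \<mu>. F R * polytabloid n \<mu> t R)"
proof -
  let ?C = "column_stabilizer n \<mu> t"
  have "column_antisymmetrizer n \<mu> t F (tabloid \<mu> t) =
      (\<Sum>\<sigma>\<in>?C. of_int (sign \<sigma>) * F (tabloid \<mu> (inv' \<sigma> \<circ> t)))"
    by (simp add: column_antisymmetrizer_def sum_fun_apply tabloid_action_def tabloid_comp)
  also have "\<dots> = (\<Sum>\<sigma>\<in>?C. of_int (sign \<sigma>) * F (tabloid \<mu> (\<sigma> \<circ> t)))"
  proof (rule sum.reindex_bij_witness[of _ inv' inv'])
    fix \<sigma> assume "\<sigma> \<in> ?C"
    then have \<sigma>: "\<sigma> permutes {1..n}"
      by (rule column_stabilizer_permutes)
    show "inv' (inv' \<sigma>) = \<sigma>"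
      by (rule permutes_inv_inv[OF \<sigma>])
    show "of_int (sign (inv' \<sigma>)) * F (tabloid \<mu> (inv' \<sigma> \<circ> t)) =
        of_int (sign \<sigma>) * F (tabloid \<mu> (inv' \<sigma> \<circ> t))"
      using sign_inverse[of \<sigma>] \<sigma> by (auto simp: permutation_permutes)
  qed (use column_stabilizer_group[OF t] permutes_inv_inv column_stabilizer_permutes in \<open>blast+\<close>)
  also have "\<dots> = (\<Sum>\<sigma>\<in>?C. \<Sum>R\<in>tabloids n \<mu>. of_int (sign \<sigma>) * (F R * dirac (tabloid \<mu> (\<sigma> \<circ> t)) R))"
  proof (rule sum.cong)
    fix \<sigma> assume "\<sigma> \<in> ?C"
    then have "tabloid \<mu> (\<sigma> \<circ> t) \<in> tabloids n \<mu>"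
      using tableau_comp(1)[OF t column_stabilizer_permutes] by (auto simp: tabloids_def)
    then have "(\<Sum>R\<in>tabloids n \<mu>. F R * dirac (tabloid \<mu> (\<sigma> \<circ> t)) R) = F (tabloid \<mu> (\<sigma> \<circ> t))"
      using finite_tabloids by (simp add: dirac_def sum_mult_indicator[unfolded indicator_def]
          indicator_def if_distrib[of "(*) _"] cong: if_cong)
    then show "of_int (sign \<sigma>) * F (tabloid \<mu> (\<sigma> \<circ> t)) =
        (\<Sum>R\<in>tabloids n \<mu>. of_int (sign \<sigma>) * (F R * dirac (tabloid \<mu> (\<sigma> \<circ> t)) R))"
      by (simp flip: sum_distrib_left)
  qed simp
  also have "\<dots> = (\<Sum>R\<in>tabloids n \<mu>. F R * polytabloid n \<mu> t R)"
    by (subst sum.swap)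
      (simp add: polytabloid_def sum_fun_apply sum_distrib_left mult.left_commute)
  finally show ?thesis .
qed

text \<open>
  James's submodule theorem. Let \<open>W\<close> be an invariant subspace. Either some antisymmetrizer does not
  vanish on \<open>W\<close>; then \<open>W\<close> contains its value, a multiple of a polytabloid, hence every polytabloid.
  Or \<open>W\<close> is orthogonal to all polytabloids, hence to itself.
\<close>

theorem irreducible_specht:
  assumes \<mu>: "integer_partition n \<mu>"
  shows "irreducible_rep (sym_group n) (specht n \<mu>) tabloid_action"
  unfolding irreducible_rep_def
proof (intro conjI allI impI)
  show "representation (sym_group n) (specht n \<mu>) tabloid_action"
    by (rule representation_specht)
  obtain t where t: "tableau n \<mu> t"
    using tableau_exists[OF \<mu>] .
  then show "specht n \<mu> \<noteq> {0}"
    using polytabloid_in_specht polytabloid_nonzero by blast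
  fix W assume W: "W \<subseteq> specht n \<mu> \<and> representation (sym_group n) W tabloid_action"
  note W' = representationD[OF conjunct2[OF W]]
  show "W = {0} \<or> W = specht n \<mu>"
  proof (cases "\<exists>t F. tableau n \<mu> t \<and> F \<in> W \<and> column_antisymmetrizer n \<mu> t F \<noteq> 0")
    case True
    then obtain t F where t: "tableau n \<mu> t" and F: "F \<in> W" "column_antisymmetrizer n \<mu> t F \<noteq> 0"
      by blast
    have "F \<in> L_space (tabloids n \<mu>)"
      using F(1) W specht_subset_L_space by blast
    then obtain c where c: "column_antisymmetrizer n \<mu> t F = c *\<^sub>R polytabloid n \<mu> t"
      using column_antisymmetrizer_in_span[OF \<mu> t] by (auto simp: span_singleton)
    have "column_antisymmetrizer n \<mu> t F \<in> W"
      unfolding column_antisymmetrizer_def using W'(2,4) F(1) column_stabilizer_permutes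
      by (intro subspace_sum subspace_scale) (auto simp: sym_group_carrier)
    then have "(1 / c) *\<^sub>R (c *\<^sub>R polytabloid n \<mu> t) \<in> W"
      unfolding c by (rule subspace_scale[OF W'(2)])
    then have et: "polytabloid n \<mu> t \<in> W"
      using c F(2) by (cases "c = 0") auto
    have "polytabloid n \<mu> s \<in> W" if s: "tableau n \<mu> s" for s
    proof -
      obtain \<sigma> where "\<sigma> permutes {1..n}" "polytabloid n \<mu> s = tabloid_action \<sigma> (polytabloid n \<mu> t)"
        using polytabloid_orbit[OF t s] .
      then show ?thesis
        using W'(4) et by (simp add: sym_group_carrier)
    qed
    then have "specht n \<mu> \<subseteq> W"
      unfolding specht_def using W'(2) by (intro span_minimal) auto
    then show ?thesis
      using W by blast
  next
    case False
    have "F = 0" if F: "F \<in> W" for F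
    proof -
      define l where "l H = (\<Sum>R\<in>tabloids n \<mu>. F R * H R)" for H :: "nat set list \<Rightarrow> real"
      have l: "linear l"
        by (rule linearI) (auto simp: l_def algebra_simps sum.distrib sum_distrib_left)
      have "l (polytabloid n \<mu> t) = 0" if "tableau n \<mu> t" for t
        using column_antisymmetrizer_coefficient[OF that, of F] False F that by (simp add: l_def)
      moreover have "F \<in> span {polytabloid n \<mu> t | t. tableau n \<mu> t}"
        using F W by (auto simp: specht_def)
      ultimately have "l F = 0"
        using linear_eq_0_on_span[OF l, of "{polytabloid n \<mu> t | t. tableau n \<mu> t}" F] by blast
      then have "\<forall>R\<in>tabloids n \<mu>. F R * F R = 0"
        unfolding l_def using finite_tabloids by (subst (asm) sum_nonneg_eq_0_iff) auto
      moreover have "F \<in> L_space (tabloids n \<mu>)"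
        using F W specht_subset_L_space by blast
      ultimately show ?thesis
        by (auto simp: L_space_def fun_eq_iff)
    qed
    then show ?thesis
      using subspace_0[OF W'(2)] by blast
  qed
qed

text \<open>
  Up to a nonzero factor, the antisymmetrizer is a projection onto the line of the polytabloid, and
  it commutes with equivariant maps; so these preserve that line. Since the polytabloid generates the
  module, all endomorphisms are scalars, although the field of real numbers is not algebraically
  closed.
\<close>

lemma specht_endomorphism_scalar:
  assumes \<mu>: "integer_partition n \<mu>" and t: "tableau n \<mu> t"
    and f: "equivariant (sym_group n) (specht n \<mu>) tabloid_action (specht n \<mu>) tabloid_action f"
  shows "f (polytabloid n \<mu> t) \<in> span {polytabloid n \<mu> t}"
proof -
  note f' = equivariantD[OF f]
  let ?e = "polytabloid n \<mu> t" and ?C = "column_stabilizer n \<mu> t"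
  have e: "?e \<in> specht n \<mu>"
    by (rule polytabloid_in_specht[OF t])
  have "real (card ?C) *\<^sub>R f ?e = f (column_antisymmetrizer n \<mu> t ?e)"
    by (simp add: column_antisymmetrizer_polytabloid[OF t] linear_scale[OF f'(1)])
  also have "\<dots> = column_antisymmetrizer n \<mu> t (f ?e)"
    unfolding column_antisymmetrizer_def linear_sum[OF f'(1)] linear_scale[OF f'(1)]
    using f'(3)[OF _ e] column_stabilizer_permutes by (intro sum.cong) (auto simp: sym_group_carrier)
  also have "\<dots> \<in> span {?e}"
    using f'(2)[OF e] specht_subset_L_space by (intro column_antisymmetrizer_in_span[OF \<mu> t]) blast
  finally have "(1 / real (card ?C)) *\<^sub>R (real (card ?C) *\<^sub>R f ?e) \<in> span {?e}"
    by (rule span_scale)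
  moreover have "card ?C \<noteq> 0"
    using finite_column_stabilizer column_stabilizer_group(1)[OF t] by auto
  ultimately show ?thesis by simp
qed

section \<open>Multiplicities of Specht modules\<close>

theorem dim_hom_values_L_sym:
  assumes "integer_partition n \<mu>" "tableau n \<mu> t"
  shows "dim (hom_values (sym_group n) (specht n \<mu>) tabloid_action (polytabloid n \<mu> t)
    (L_sym n) regular_action) = dim (specht n \<mu>)"
  unfolding L_sym_def
proof (rule dim_hom_values_regular[OF representation_specht polytabloid_in_specht[OF assms(2)]])
  show "specht n \<mu> = span ((\<lambda>g. tabloid_action g (polytabloid n \<mu> t)) ` carrier (sym_group n))"
    using irreducible_rep_span_orbit[OF irreducible_specht[OF assms(1)]
        polytabloid_in_specht polytabloid_nonzero] assms(2) by blast
  show "finite (carrier (sym_group n))"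
    by (simp add: sym_group_def finite_permutations)
  show "regular_action g F h = F (h \<otimes>\<^bsub>sym_group n\<^esub> g)" for g F h
    by (simp add: regular_action_def sym_group_mult)
  show "regular_action g F \<in> L_space (carrier (sym_group n))"
    if "g \<in> carrier (sym_group n)" "F \<in> L_space (carrier (sym_group n))" for g F
    using representationD(4)[OF representation_L_sym] that unfolding L_sym_def by blast
qed

lemma H_total_eq_sum_H_level:
  "H_total n = subspace_sum ({0} \<union> {2..n}) (H_level n)"
proof -
  have "\<P>bar {1..n} = (\<Union>k\<in>{0} \<union> {2..n}. {B. B \<subseteq> {1..n} \<and> card B = k})"
    using card_mono[of "{1..n}"] finite_subset[of _ "{1..n}"] by (auto simp: \<P>bar_def \<P>_def)
  moreover have "subspace_sum (\<Union>k\<in>{0} \<union> {2..n}. {B. B \<subseteq> {1..n} \<and> card B = k}) (H_space n) =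
      subspace_sum ({0} \<union> {2..n}) (\<lambda>k. subspace_sum {B. B \<subseteq> {1..n} \<and> card B = k} (H_space n))"
    by (rule subspace_sum_UN) auto
  ultimately show ?thesis
    by (simp add: H_total_def H_level_def[abs_def])
qed

lemma H_level_subset_\<P>bar:
  assumes "k \<in> {0} \<union> {2..n}"
  shows "{B. B \<subseteq> {1..n} \<and> card B = k} \<subseteq> \<P>bar {1..n}"
  using assms finite_subset[of _ "{1..n}"] by (auto simp: \<P>bar_def \<P>_def)

lemma representation_H_level:
  assumes "k \<in> {0} \<union> {2..n}"
  shows "representation (sym_group n) (H_level n k) word_action"
  unfolding H_level_def
proof (rule representation_subspace_sum_H_space[OF H_level_subset_\<P>bar[OF assms]])
  fix \<sigma> B assume "\<sigma> permutes {1..n}" "B \<in> {B. B \<subseteq> {1..n} \<and> card B = k}"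
  then show "\<sigma> ` B \<in> {B. B \<subseteq> {1..n} \<and> card B = k}"
    using permutes_image_subset_card[of \<sigma> n B] by blast
qed

text \<open>Functions in different levels have disjoint supports, as level \<open>k\<close> lives on words of length \<open>k\<close>.\<close>

lemma independent_family_H_level: "independent_family ({0} \<union> {2..n}) (H_level n)"
  unfolding independent_family_def
proof (intro allI impI ballI)
  let ?K = "{0} \<union> {2..n}"
  fix f k assume f: "(\<forall>k\<in>?K. f k \<in> H_level n k) \<and> sum f ?K = 0" and k: "k \<in> ?K"
  have "f j \<pi> = 0" if "j \<in> ?K" "length \<pi> \<noteq> j" for j \<pi>
  proof -
    have "H_level n j \<subseteq> L_space {\<pi>. length \<pi> = j}"
      unfolding H_level_def
    proof (rule subspace_sum_subset[OF subspace_L_space])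
      fix B assume B: "B \<in> {B. B \<subseteq> {1..n} \<and> card B = j}"
      have "\<Gamma> B \<subseteq> {\<pi>. length \<pi> = j}"
        using B distinct_card by (fastforce simp: \<Gamma>_def)
      then show "H_space n B \<subseteq> L_space {\<pi>. length \<pi> = j}"
        using B H_level_subset_\<P>bar[OF that(1)] H_space_iff[of B n] by (auto simp: L_space_def)
    qed
    moreover have "f j \<in> H_level n j"
      using f that(1) by blast
    ultimately show ?thesis
      using that(2) unfolding L_space_def by blast
  qed
  then have "f k \<pi> = (\<Sum>j\<in>?K. f j \<pi>)" if "length \<pi> = k" for \<pi>
    using k that by (subst sum.remove[of ?K k]) (auto intro!: sum.neutral[symmetric])
  then have "f k \<pi> = 0" for \<pi>
    using f k \<open>\<And>j \<pi>. j \<in> ?K \<Longrightarrow> length \<pi> \<noteq> j \<Longrightarrow> f j \<pi> = 0\<close> sum_fun_apply[of f ?K \<pi>]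
    by (cases "length \<pi> = k") auto
  then show "f k = 0"
    by (simp add: fun_eq_iff)
qed

text \<open>
  Each \<open>\<kappa> n \<mu> k\<close> counts the copies of the Specht module in a chosen decomposition of level \<open>k\<close>, and the
  union of these decompositions is one of \<open>H_total n\<close>, where the count is a dimension that can be
  computed in the regular representation.
\<close>

theorem sum_\<kappa>_eq_dim_specht:
  assumes \<mu>: "integer_partition n \<mu>"
  shows "(\<Sum>k\<in>{0} \<union> {2..n}. \<kappa> n \<mu> k) = dim (specht n \<mu>)"
proof -
  let ?G = "sym_group n" and ?K = "{0} \<union> {2..n}" and ?S = "specht n \<mu>"
  obtain t where t: "tableau n \<mu> t"
    using tableau_exists[OF \<mu>] .
  let ?e = "polytabloid n \<mu> t"
  note S = irreducible_specht[OF \<mu>] polytabloid_in_specht[OF t] polytabloid_nonzero[OF t]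
    specht_endomorphism_scalar[OF \<mu> t]
  have mult: "multiplicity_rep ?G ?S tabloid_action V word_action =
      card {W \<in> \<X>. rep_isomorphic ?G ?S tabloid_action W word_action}"
    if "irreducible_decomposition ?G V word_action \<X>" for V :: "(nat list \<Rightarrow> real) set" and \<X>
    by (rule multiplicity_rep_eq_card[OF S(1-3) _ that]) (rule S(4))
  have finG: "finite (carrier ?G)"
    by (simp add: sym_group_def finite_permutations)
  have "\<exists>\<W>. irreducible_decomposition ?G (H_level n k) word_action \<W>" if k: "k \<in> ?K" for k
  proof (rule irreducible_decomposition_exists[OF representation_H_level[OF k] finG])
    have "H_level n k \<subseteq> L_space (\<Gamma>bar n)"
      unfolding H_level_def
    proof (rule subspace_sum_subset[OF subspace_L_space])
      fix B assume "B \<in> {B. B \<subseteq> {1..n} \<and> card B = k}"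
      then have B: "B \<in> \<P>bar {1..n}"
        using H_level_subset_\<P>bar[OF k] by blast
      show "H_space n B \<subseteq> L_space (\<Gamma>bar n)"
        using H_space_iff[OF B] \<Gamma>_subset_\<Gamma>bar[OF B] unfolding L_space_def by blast
    qed
    then show "H_level n k \<subseteq> span (dirac ` \<Gamma>bar n)"
      using L_space_subset_span_dirac[OF finite_\<Gamma>bar] by blast
    show "finite (dirac ` \<Gamma>bar n :: (nat list \<Rightarrow> real) set)"
      by (intro finite_imageI finite_\<Gamma>bar)
  qed
  then obtain \<W> where \<W>: "\<And>k. k \<in> ?K \<Longrightarrow> irreducible_decomposition ?G (H_level n k) word_action (\<W> k)"
    by metis
  let ?iso = "\<lambda>W. rep_isomorphic ?G ?S tabloid_action W word_action"
  have total: "irreducible_decomposition ?G (H_total n) word_action (\<Union>k\<in>?K. \<W> k)"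
    and disj: "\<And>j k. j \<in> ?K \<Longrightarrow> k \<in> ?K \<Longrightarrow> j \<noteq> k \<Longrightarrow> \<W> j \<inter> \<W> k = {}"
    using irreducible_decomposition_Union[OF \<W> _ independent_family_H_level]
      representationD(2)[OF representation_H_level] unfolding H_total_eq_sum_H_level by auto
  have "(\<Sum>k\<in>?K. \<kappa> n \<mu> k) = (\<Sum>k\<in>?K. card {W \<in> \<W> k. ?iso W})"
    unfolding \<kappa>_def using mult[OF \<W>] by (intro sum.cong) auto
  also have "\<dots> = card (\<Union>k\<in>?K. {W \<in> \<W> k. ?iso W})"
  proof (rule card_UN_disjoint[symmetric])
    show "\<forall>k\<in>?K. finite {W \<in> \<W> k. ?iso W}"
      using \<W> by (auto simp: irreducible_decomposition_def)
    show "\<forall>j\<in>?K. \<forall>k\<in>?K. j \<noteq> k \<longrightarrow> {W \<in> \<W> j. ?iso W} \<inter> {W \<in> \<W> k. ?iso W} = {}"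
      using disj by blast
  qed simp
  also have "(\<Union>k\<in>?K. {W \<in> \<W> k. ?iso W}) = {W \<in> (\<Union>k\<in>?K. \<W> k). ?iso W}"
    by blast
  also have "card \<dots> = dim (hom_values ?G ?S tabloid_action ?e (H_total n) word_action)"
    by (rule card_isomorphic_summands[OF S(1-3) _ total]) (rule S(4))
  also have "\<dots> = dim (hom_values ?G ?S tabloid_action ?e (L_sym n) regular_action)"
    by (rule dim_hom_values_isomorphic[OF H_total_isomorphic_L_sym S(2)])
  also have "\<dots> = dim ?S"
    by (rule dim_hom_values_L_sym[OF \<mu> t])
  finally show ?thesis .
qed

theorem proposition33:
  fixes n :: nat
  assumes "n \<ge> 1"
  shows "rep_isomorphic (sym_group n) (L_sym n) regular_action (H_total n) word_action \<and>
    (\<forall>\<mu>. integer_partition n \<mu> \<longrightarrow> (\<Sum>k\<in>{0} \<union> {2..n}. \<kappa> n \<mu> k) = dim (specht n \<mu>))"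
  using rep_isomorphic_sym[OF H_total_isomorphic_L_sym] sum_\<kappa>_eq_dim_specht by blast

end
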